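(* Let $p\in(0,1)$ be a fixed constant. For an even integer $n=2s$, let $M$ be the $n\times n$ matrix with $m_{ij}=p$ if $1\le|i-j|\le s-1$ and $0$ otherwise, and let $\widehat M$ be a random symmetric $n\times n$ matrix with zero diagonal whose entries $\widehat m_{ij}$, $i<j$, are independent Bernoulli variables with $\mathbb P(\widehat m_{ij}=1)=m_{ij}$. Let $u\in\mathbb R^n$ be given by $u_j=\cos\left(\frac{(2j-1)\pi}{4s+2}\right)$ for $j=1,\dots,s$ and $u_j=-u_{n-j+1}$ for $j=s+1,\dots,n$, and let $y$ be a unit eigenvector of $\widehat M$ for $\lambda_2(\widehat M)$ with sign chosen so that $\langle y,u\rangle\ge0$. Then there is a constant $C>0$ (independent of $n$) such that, with probability at least $1-n^{-3}$, $D(\sigma_y)\le Cn^{9/5}$; i.e. $D(\sigma_y)=\mathcal O(n^{9/5})$ with probability $1-n^{-3}$.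
   Context: Eigenvalues of a symmetric matrix $X$ are labelled so that $|\lambda_1(X)|\ge|\lambda_2(X)|\ge\dots$; $\lambda_2(X)$ is the one of second largest absolute value. For $y\in\mathbb R^n$, $\sigma_y$ is a permutation of $\{1,\dots,n\}$ with $y_{\sigma_y(1)}\ge y_{\sigma_y(2)}\ge\dots\ge y_{\sigma_y(n)}$, and for a permutation $\sigma$ the Kendall distance is $D(\sigma)=\sum_{i<j}\mathbf 1_{\sigma(i)>\sigma(j)}$. *)

theory Defs
  imports "HOL-Probability.Product_PMF" "Jordan_Normal_Form.Char_Poly"
begin

(* All matrices/vectors are JNF matrices/vectors with 0-based indices 0..n-1;
   paper index i (1-based) corresponds to JNF index i-1. *)

definition band_M :: "real \<Rightarrow> nat \<Rightarrow> real mat" where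
  "band_M p s = mat (2 * s) (2 * s) (\<lambda>(i,j).
     (let d = (if i \<le> j then j - i else i - j) in
     if 1 \<le> d \<and> d \<le> s - 1 then p else 0))"

definition random_M :: "real \<Rightarrow> nat \<Rightarrow> real mat pmf" where
  "random_M p s =
     map_pmf (\<lambda>b. mat (2 * s) (2 * s) (\<lambda>(i,j).
                 if i = j then 0 else if b (min i j, max i j) then 1 else 0))
       (Pi_pmf {(i,j). i < j \<and> j < 2 * s} False
          (\<lambda>(i,j). bernoulli_pmf (band_M p s $$ (i,j))))"

definition u_fun :: "nat \<Rightarrow> nat \<Rightarrow> real" where
  "u_fun s j = (if j \<le> s then cos ((2 * real j - 1) * pi / (4 * real s + 2))
                else - cos ((2 * real (2 * s - j + 1) - 1) * pi / (4 * real s + 2)))"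

definition u_vec :: "nat \<Rightarrow> real vec" where
  "u_vec s = vec (2 * s) (\<lambda>j. u_fun s (j+1))"

(* lam is a value of \<lambda>_2(A): for some listing of the eigenvalues of A with
   multiplicity (roots of the characteristic polynomial) ordered so that
   |\<lambda>_1| \<ge> |\<lambda>_2| \<ge> ..., lam is the second entry. *)
definition is_lambda2 :: "real mat \<Rightarrow> real \<Rightarrow> bool" where
  "is_lambda2 A lam \<longleftrightarrow> (\<exists>es. char_poly A = (\<Prod>e\<leftarrow>es. [:- e, 1:]) \<and>
      sorted_wrt (\<lambda>a b. \<bar>b\<bar> \<le> \<bar>a\<bar>) es \<and> 1 < length es \<and> es ! 1 = lam)"

definition sorts :: "nat \<Rightarrow> (nat \<Rightarrow> nat) \<Rightarrow> real vec \<Rightarrow> bool" where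
  "sorts n \<sigma> y \<longleftrightarrow> \<sigma> permutes {..<n} \<and>
      (\<forall>i j. i < j \<and> j < n \<longrightarrow> y $ (\<sigma> j) \<le> y $ (\<sigma> i))"

definition kendall :: "nat \<Rightarrow> (nat \<Rightarrow> nat) \<Rightarrow> nat" where
  "kendall n \<sigma> = card {(i,j). i < j \<and> j < n \<and> \<sigma> j < \<sigma> i}"

end

theory Submission
  imports Defs "HOL-Probability.Hoeffding" "Jordan_Normal_Form.Schur_Decomposition"
begin

text \<open>
  The vector \<open>u\<close> is an exact eigenvector of \<open>M\<close>, with eigenvalue \<open>\<mu> \<approx> 2 p s / \<pi>\<close>, and Hoeffding's
  inequality with a net gives \<open>\<parallel>A - M\<parallel> = O(n\<^sup>1\<^sup>/\<^sup>2)\<close> for the random matrix \<open>A\<close>. No further knowledge of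
  the spectrum of \<open>M\<close> is needed: its Hilbert--Schmidt norm squared is at most \<open>3 (p s)\<^sup>2\<close>, the all-ones
  vector forces \<open>\<bar>\<lambda>\<^sub>1(A)\<bar> \<ge> 1.498 p s\<close>, and \<open>u\<close> forces \<open>\<bar>\<lambda>\<^sub>2(A)\<bar> \<ge> 0.623 p s\<close>. What is left of the Hilbert--Schmidt
  norm only allows \<open>\<bar>\<lambda>\<^sub>k(A)\<bar> \<le> 0.612 p s\<close> for \<open>k \<ge> 3\<close>, so \<open>\<lambda>\<^sub>2(A)\<close> is separated from the rest by a gap linear in \<open>n\<close>
  and the unit eigenvector \<open>y\<close> is within \<open>O(n\<^sup>-\<^sup>1\<^sup>/\<^sup>2)\<close> of \<open>u / \<parallel>u\<parallel>\<close>. Finally \<open>u\<close> decreases, with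
  \<open>u\<^sub>i - u\<^sub>j \<ge> 2 (j - i)\<^sup>2 / (n + 1)\<^sup>2\<close>, so an inverted pair is either close together or contains one of
  the few indices where \<open>y\<close> is far from \<open>u\<close>.
\<close>

section \<open>Eigenbases of symmetric matrices\<close>

text \<open>Vectors are total functions of which only the entries below \<open>n\<close> count, and
  matrices are functions of two indices. This spares the dimension conditions of carrier sets; the
  matrix library is entered only for the Schur decomposition, a one-sided inverse and the final
  translation.\<close>

definition ip :: "nat \<Rightarrow> (nat \<Rightarrow> real) \<Rightarrow> (nat \<Rightarrow> real) \<Rightarrow> real" where
  "ip n x y = (\<Sum>i<n. x i * y i)"

definition mv :: "nat \<Rightarrow> (nat \<Rightarrow> nat \<Rightarrow> real) \<Rightarrow> (nat \<Rightarrow> real) \<Rightarrow> nat \<Rightarrow> real" where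
  "mv n A x i = (\<Sum>j<n. A i j * x j)"

definition nrm :: "nat \<Rightarrow> (nat \<Rightarrow> real) \<Rightarrow> real" where
  "nrm n x = L2_set x {..<n}"

definition orthonormal :: "nat \<Rightarrow> nat \<Rightarrow> (nat \<Rightarrow> nat \<Rightarrow> real) \<Rightarrow> bool" where
  "orthonormal n m f \<longleftrightarrow> (\<forall>k<m. \<forall>l<m. ip n (f k) (f l) = (if k = l then 1 else 0))"

definition in_span :: "nat \<Rightarrow> nat \<Rightarrow> (nat \<Rightarrow> nat \<Rightarrow> real) \<Rightarrow> (nat \<Rightarrow> real) \<Rightarrow> bool" where
  "in_span n m p x \<longleftrightarrow> (\<exists>c. \<forall>i<n. x i = (\<Sum>l<m. c l * p l i))"

section \<open>Calculus of the inner product, the matrix action and the norm\<close>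

lemma ip_commute: "ip n x y = ip n y x"
  by (simp add: ip_def mult.commute)

lemma ip_cong: "(\<And>i. i < n \<Longrightarrow> x i = x' i) \<Longrightarrow> (\<And>i. i < n \<Longrightarrow> y i = y' i) \<Longrightarrow> ip n x y = ip n x' y'"
  by (simp add: ip_def)

lemma ip_diff_left: "ip n (\<lambda>i. x i - y i) z = ip n x z - ip n y z"
  by (simp add: ip_def algebra_simps sum_subtractf)

lemma ip_scale_left: "ip n (\<lambda>i. c * x i) z = c * ip n x z"
  by (simp add: ip_def sum_distrib_left mult.assoc)

lemma ip_diff_right: "ip n z (\<lambda>i. x i - y i) = ip n z x - ip n z y"
  by (simp add: ip_def algebra_simps sum_subtractf)

lemma ip_scale_right: "ip n z (\<lambda>i. c * x i) = c * ip n z x"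
  by (simp add: ip_def sum_distrib_left mult.left_commute)

lemma ip_sum_left: "ip n (\<lambda>i. \<Sum>k\<in>K. c k * f k i) z = (\<Sum>k\<in>K. c k * ip n (f k) z)"
  unfolding ip_def sum_distrib_left sum_distrib_right mult.assoc by (rule sum.swap)

lemmas ip_linear = ip_diff_left ip_scale_left ip_diff_right ip_scale_right

lemma mv_cong: "(\<And>i. i < n \<Longrightarrow> x i = y i) \<Longrightarrow> mv n A x = mv n A y"
  by (auto simp: mv_def)

lemma mv_diff: "mv n A (\<lambda>i. x i - y i) i = mv n A x i - mv n A y i"
  by (simp add: mv_def algebra_simps sum_subtractf)

lemma mv_scale: "mv n A (\<lambda>i. c * x i) i = c * mv n A x i"
  by (simp add: mv_def sum_distrib_left mult.left_commute)

lemma mv_sum: "mv n A (\<lambda>i. \<Sum>k\<in>K. c k * f k i) i = (\<Sum>k\<in>K. c k * mv n A (f k) i)"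
  unfolding mv_def sum_distrib_left by (subst sum.swap) (simp add: mult.left_commute)

lemma mv_ip: "mv n A x i = ip n (A i) x"
  by (simp add: mv_def ip_def)

lemma ip_mv_symmetric:
  assumes "\<And>i j. i < n \<Longrightarrow> j < n \<Longrightarrow> A i j = A j i"
  shows "ip n (mv n A x) y = ip n x (mv n A y)"
proof -
  have "ip n (mv n A x) y = (\<Sum>i<n. \<Sum>j<n. A i j * x j * y i)"
    by (simp add: ip_def mv_def sum_distrib_right)
  also have "\<dots> = (\<Sum>j<n. \<Sum>i<n. A i j * x j * y i)"
    by (rule sum.swap)
  also have "\<dots> = ip n x (mv n A y)"
    unfolding ip_def mv_def sum_distrib_left
    by (intro sum.cong refl) (use assms in auto)
  finally show ?thesis .
qed

lemma nrm_sq: "(nrm n x)\<^sup>2 = ip n x x"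
  by (simp add: nrm_def L2_set_def ip_def power2_eq_square sum_nonneg flip: real_sqrt_mult)

lemma nrm_nonneg [simp]: "0 \<le> nrm n x"
  by (simp add: nrm_def)

lemma nrm_cong: "(\<And>i. i < n \<Longrightarrow> x i = x' i) \<Longrightarrow> nrm n x = nrm n x'"
  by (simp add: nrm_def L2_set_def)

lemma ip_self: "ip n x x = (\<Sum>i<n. (x i)\<^sup>2)"
  by (simp add: ip_def power2_eq_square)

lemma ip_self_nonneg [simp]: "0 \<le> ip n x x"
  by (simp flip: nrm_sq)

lemma ip_self_eq_0_iff: "ip n x x = 0 \<longleftrightarrow> (\<forall>i<n. x i = 0)"
  by (auto simp: ip_def sum_nonneg_eq_0_iff)

lemma nrm_triangle: "nrm n (\<lambda>i. x i + y i) \<le> nrm n x + nrm n y"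
  unfolding nrm_def by (rule L2_set_triangle_ineq)

lemma nrm_uminus: "nrm n (\<lambda>i. - x i) = nrm n x"
  by (simp add: nrm_def L2_set_def)

lemma nrm_diff_le: "nrm n x \<le> nrm n y + nrm n (\<lambda>i. x i - y i)"
  using nrm_triangle[of n y "\<lambda>i. x i - y i"] by simp

lemma nrm_diff_commute: "nrm n (\<lambda>i. x i - y i) = nrm n (\<lambda>i. y i - x i)"
  using nrm_uminus[of n "\<lambda>i. x i - y i"] by simp

lemma nrm_scale: "nrm n (\<lambda>i. c * x i) = \<bar>c\<bar> * nrm n x"
  unfolding nrm_def L2_set_def
  by (simp add: power_mult_distrib real_sqrt_mult flip: sum_distrib_left)

lemma abs_ip_le: "\<bar>ip n x y\<bar> \<le> nrm n x * nrm n y"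
  unfolding ip_def nrm_def
  by (rule order_trans[OF sum_abs]) (simp add: abs_mult L2_set_mult_ineq)

section \<open>Spans and orthonormal coefficients\<close>

lemma in_span_trans:
  assumes "in_span n m f x" and "\<And>k. k < m \<Longrightarrow> in_span n m' p (f k)"
  shows "in_span n m' p x"
proof -
  obtain c where c: "\<And>i. i < n \<Longrightarrow> x i = (\<Sum>l<m. c l * f l i)"
    using assms(1) unfolding in_span_def by blast
  obtain d where d: "\<And>k i. k < m \<Longrightarrow> i < n \<Longrightarrow> f k i = (\<Sum>l<m'. d k l * p l i)"
    using assms(2) unfolding in_span_def by metis
  have "x i = (\<Sum>l<m'. (\<Sum>k<m. c k * d k l) * p l i)" if "i < n" for i
  proof -
    have "x i = (\<Sum>k<m. \<Sum>l<m'. c k * d k l * p l i)"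
      using that c d by (simp add: sum_distrib_left mult.assoc)
    also have "\<dots> = (\<Sum>l<m'. (\<Sum>k<m. c k * d k l) * p l i)"
      by (subst sum.swap) (simp add: sum_distrib_right)
    finally show ?thesis .
  qed
  then show ?thesis unfolding in_span_def
    by (intro exI[of _ "\<lambda>l. \<Sum>k<m. c k * d k l"]) simp
qed

lemma in_span_sum: "in_span n m f (\<lambda>i. \<Sum>l<m. c l * f l i)"
  unfolding in_span_def by (rule exI[of _ c]) simp

lemma in_span_lin:
  assumes "in_span n m f x" "in_span n m f y"
  shows "in_span n m f (\<lambda>i. a * x i + b * y i)"
proof -
  obtain c where c: "\<And>i. i < n \<Longrightarrow> x i = (\<Sum>l<m. c l * f l i)"
    using assms(1) unfolding in_span_def by blast
  obtain d where d: "\<And>i. i < n \<Longrightarrow> y i = (\<Sum>l<m. d l * f l i)"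
    using assms(2) unfolding in_span_def by blast
  show ?thesis unfolding in_span_def
    by (rule exI[of _ "\<lambda>l. a * c l + b * d l"])
      (simp add: c d sum_distrib_left algebra_simps sum.distrib)
qed

lemma in_span_base:
  assumes "k < m"
  shows "in_span n m f (f k)"
proof -
  have "f k i = (\<Sum>l<m. (if l = k then 1 else 0) * f l i)" for i
  proof -
    have "(\<Sum>l<m. (if l = k then 1 else 0) * f l i) = (\<Sum>l<m. if l = k then f k i else 0)"
      by (intro sum.cong) auto
    then show ?thesis using assms by simp
  qed
  then show ?thesis unfolding in_span_def
    by (intro exI[of _ "\<lambda>l. if l = k then 1 else 0"]) simp
qed

lemma in_span_Suc:
  assumes "in_span n m f x"
  shows "in_span n (Suc m) f x"
  using assms by (rule in_span_trans) (simp add: in_span_base)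

lemma in_span_cong:
  assumes "in_span n m f x" "\<And>i. i < n \<Longrightarrow> x i = y i" "\<And>l i. l < m \<Longrightarrow> i < n \<Longrightarrow> f l i = g l i"
  shows "in_span n m g y"
  using assms unfolding in_span_def by simp

lemma orthonormal_coeff:
  assumes "orthonormal n m f" "l < m"
  shows "ip n (\<lambda>i. \<Sum>k<m. c k * f k i) (f l) = c l"
proof -
  have "ip n (\<lambda>i. \<Sum>k<m. c k * f k i) (f l) = (\<Sum>k<m. c k * (if k = l then 1 else 0))"
    using assms unfolding ip_sum_left orthonormal_def by (intro sum.cong) auto
  also have "\<dots> = c l" using assms(2) by (simp add: if_distrib cong: if_cong)
  finally show ?thesis .
qed

text \<open>Gram--Schmidt on the columns \<open>p l\<close> of a triangularising matrix: the new direction \<open>g\<close> satisfies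
  \<open>A g = B m m g + h\<close> with \<open>h\<close> in the span of the previous eigenvectors, and symmetry makes \<open>h\<close>
  orthogonal to these, so \<open>h = 0\<close>.\<close>

lemma triangularised_symmetric_eigenbasis:
  assumes sym: "\<And>i j. i < n \<Longrightarrow> j < n \<Longrightarrow> A i j = A j i"
    and Ap: "\<And>k i. k < n \<Longrightarrow> i < n \<Longrightarrow> mv n A (p k) i = (\<Sum>l\<le>k. B l k * p l i)"
    and indep: "\<And>c. \<forall>i<n. (\<Sum>l<n. c l * p l i) = 0 \<Longrightarrow> \<forall>l<n. c l = 0"
    and "m \<le> n"
  shows "\<exists>f. orthonormal n m f \<and> (\<forall>k<m. \<forall>i<n. mv n A (f k) i = B k k * f k i) \<and>
    (\<forall>k<m. in_span n m p (f k)) \<and> (\<forall>k<m. in_span n m f (p k))"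
  using \<open>m \<le> n\<close>
\<comment> \<open>Both span inclusions are carried through the induction: the first turns a
  vanishing new direction into a linear dependence among the columns \<open>p l\<close>, the second
  places the remainder \<open>h\<close> in the span of the earlier eigenvectors.\<close>
proof (induction m)
  case 0
  show ?case by (auto simp: orthonormal_def)
next
  case (Suc m)
  then obtain f where on: "orthonormal n m f"
    and ev: "\<And>k i. k < m \<Longrightarrow> i < n \<Longrightarrow> mv n A (f k) i = B k k * f k i"
    and fp: "\<And>k. k < m \<Longrightarrow> in_span n m p (f k)"
    and pf: "\<And>k. k < m \<Longrightarrow> in_span n m f (p k)"
    by auto
  have mn: "m < n" using Suc.prems by simp
  define a where "a = (\<lambda>k. ip n (p m) (f k))"
  define q where "q = (\<lambda>i. \<Sum>k<m. a k * f k i)"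
  define g where "g = (\<lambda>i. p m i - q i)"
  have qf: "in_span n m f q" unfolding q_def by (rule in_span_sum)
  have qp: "in_span n m p q" by (rule in_span_trans[OF qf fp])
  have g_orth: "ip n g (f k) = 0" if "k < m" for k
    unfolding g_def ip_diff_left q_def orthonormal_coeff[OF on that] by (simp add: a_def)
  have g_pos: "ip n g g \<noteq> 0"
  proof
    assume "ip n g g = 0"
    then have g0: "\<And>i. i < n \<Longrightarrow> p m i = q i" by (simp add: ip_self_eq_0_iff g_def)
    obtain c where c: "\<And>i. i < n \<Longrightarrow> q i = (\<Sum>l<m. c l * p l i)"
      using qp unfolding in_span_def by blast
    \<comment> \<open>If \<open>g\<close> vanished, \<open>p m\<close> would be a combination of
      earlier columns; \<open>c'\<close> is that dependence, with coefficient 1 at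
      \<open>m\<close>.\<close>
    define c' where "c' = (\<lambda>l. if l < m then - c l else if l = m then 1 else 0)"
    have "(\<Sum>l<n. c' l * p l i) = 0" if "i < n" for i
    proof -
      have "(\<Sum>l<n. c' l * p l i) = (\<Sum>l<Suc m. c' l * p l i)"
        by (rule sum.mono_neutral_right) (use mn in \<open>auto simp: c'_def\<close>)
      also have "\<dots> = (\<Sum>l<m. - (c l * p l i)) + p m i"
        by (simp add: c'_def)
      also have "\<dots> = 0" using g0[OF that] c[OF that] by (simp add: sum_negf)
      finally show ?thesis .
    qed
    then have "c' m = 0" using indep mn by blast
    then show False by (simp add: c'_def)
  qed
  define h where "h = (\<lambda>i. (\<Sum>l<m. B l m * p l i) + (\<Sum>k<m. (B m m - B k k) * a k * f k i))"
  have Ag: "mv n A g i = B m m * g i + h i" if "i < n" for i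
  proof -
    have "mv n A q i = (\<Sum>k<m. a k * (B k k * f k i))"
      unfolding q_def mv_sum using ev that by (intro sum.cong) auto
    moreover have "(\<Sum>k<m. (B m m - B k k) * a k * f k i)
        = B m m * q i - (\<Sum>k<m. a k * (B k k * f k i))"
      unfolding q_def sum_distrib_left by (simp add: algebra_simps sum_subtractf)
    ultimately show ?thesis
      unfolding g_def mv_diff Ap[OF mn that] h_def
      by (simp add: lessThan_Suc_atMost[symmetric] algebra_simps)
  qed
  have "in_span n m f (\<lambda>i. \<Sum>l<m. B l m * p l i)"
    by (rule in_span_trans[OF in_span_sum pf])
  from in_span_lin[OF this in_span_sum[of n m f "\<lambda>k. (B m m - B k k) * a k"], of 1 1]
  have "in_span n m f h" unfolding h_def by simp
  then obtain e where e: "\<And>i. i < n \<Longrightarrow> h i = (\<Sum>k<m. e k * f k i)"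
    unfolding in_span_def by blast
  have "e k = 0" if k: "k < m" for k
  proof -
    have "e k = ip n (\<lambda>i. \<Sum>k<m. e k * f k i) (f k)" using orthonormal_coeff[OF on k] by simp
    also have "\<dots> = ip n (\<lambda>i. mv n A g i - B m m * g i) (f k)"
      by (rule ip_cong) (simp_all add: Ag e)
    also have "\<dots> = ip n g (mv n A (f k))"
      unfolding ip_linear using g_orth[OF k] ip_mv_symmetric[of n A g "f k"] sym by simp
    also have "\<dots> = ip n g (\<lambda>i. B k k * f k i)"
      by (rule ip_cong) (use ev k in auto)
    also have "\<dots> = 0" using g_orth[OF k] by (simp add: ip_linear)
    finally show ?thesis .
  qed
  then have h0: "h i = 0" if "i < n" for i using e[OF that] by simp
  define r where "r = nrm n g"
  have r2: "r * r = ip n g g" unfolding r_def by (simp add: nrm_sq flip: power2_eq_square)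
  then have r0: "r \<noteq> 0" using g_pos by auto
  define F where "F = f(m := (\<lambda>i. (1 / r) * g i))"
  have Ff: "F k = f k" if "k < m" for k using that by (simp add: F_def)
  have "ip n (F k) (F l) = (if k = l then 1 else 0)" if kl: "k < Suc m" "l < Suc m" for k l
  proof -
    consider "k < m" "l < m" | "k = m" "l < m" | "k < m" "l = m" | "k = m" "l = m"
      using kl by (auto simp: less_Suc_eq)
    then show ?thesis
    proof cases
      case 1 then show ?thesis using on by (simp add: Ff orthonormal_def)
    next
      case 2 then show ?thesis using g_orth[of l]
        unfolding F_def \<open>k = m\<close> fun_upd_same ip_scale_left by simp
    next
      case 3 then show ?thesis using g_orth[of k]
        unfolding F_def \<open>l = m\<close> fun_upd_same ip_scale_right by (simp add: ip_commute[of n "f k"])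
    next
      case 4
      have "ip n (F m) (F m) = (1/r) * ((1/r) * (r * r))"
        unfolding F_def fun_upd_same ip_scale_right ip_scale_left r2 ..
      then show ?thesis using 4 r0 by simp
    qed
  qed
  then have "orthonormal n (Suc m) F" by (auto simp: orthonormal_def)
  moreover have "mv n A (F k) i = B k k * F k i" if "k < Suc m" "i < n" for k i
  proof (cases "k < m")
    case True then show ?thesis using ev that by (simp add: Ff)
  next
    case False
    then have "k = m" using that by simp
    then show ?thesis using Ag[OF that(2)] h0[OF that(2)]
      unfolding F_def fun_upd_same \<open>k = m\<close> mv_scale by simp
  qed
  moreover have "in_span n (Suc m) p (F k)" if "k < Suc m" for k
  proof (cases "k < m")
    case True then show ?thesis using in_span_Suc[OF fp] by (simp add: Ff)
  next
    case False
    then have "k = m" using that by simp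
    have "in_span n (Suc m) p (\<lambda>i. (1/r) * p m i + (-1/r) * q i)"
      by (intro in_span_lin in_span_base in_span_Suc qp) simp
    then show ?thesis unfolding \<open>k = m\<close> F_def
      by (rule in_span_cong) (auto simp: g_def diff_divide_distrib)
  qed
  moreover have "in_span n (Suc m) F (p k)" if "k < Suc m" for k
  proof -
    have lift: "in_span n (Suc m) F x" if x: "in_span n m f x" for x
    proof -
      have "in_span n m F x" by (rule in_span_cong[OF x]) (simp_all add: Ff)
      then show ?thesis by (rule in_span_Suc)
    qed
    show ?thesis
    proof (cases "k < m")
      case True then show ?thesis using lift[OF pf] by simp
    next
      case False
      then have "k = m" using that by simp
      have "in_span n (Suc m) F (\<lambda>i. r * F m i + 1 * q i)"
        by (intro in_span_lin in_span_base lift qf) simp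
      then show ?thesis unfolding \<open>k = m\<close>
        by (rule in_span_cong) (auto simp: g_def F_def r0)
    qed
  qed
  ultimately show ?case by blast
qed

text \<open>The Schur decomposition puts \<open>es\<close> on the diagonal of the triangular factor
  in the given order, and Gram--Schmidt on the columns of \<open>P\<close> keeps this order. Hence
  \<open>f k\<close> belongs to \<open>es ! k\<close>, which is what a listing sorted by absolute
  value requires.\<close>

lemma symmetric_eigenbasis:
  fixes A :: "real mat"
  assumes A: "A \<in> carrier_mat n n"
    and sym: "\<And>i j. i < n \<Longrightarrow> j < n \<Longrightarrow> A $$ (i,j) = A $$ (j,i)"
    and cp: "char_poly A = (\<Prod>e\<leftarrow>es. [:- e, 1:])"
  obtains f where "length es = n" "orthonormal n n f"
    "\<And>k i. k < n \<Longrightarrow> i < n \<Longrightarrow> mv n (\<lambda>i j. A $$ (i,j)) (f k) i = es ! k * f k i"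
proof -
  obtain B P Q where BPQ: "schur_decomposition A es = (B,P,Q)"
    by (cases "schur_decomposition A es") auto
  from schur_decomposition[OF A cp BPQ]
  have sim: "similar_mat_wit A B P Q" and ut: "upper_triangular B" and dg: "diag_mat B = es"
    by auto
  note w = similar_mat_witD2[OF A sim]
  have len: "length es = n" using dg w by (auto simp: diag_mat_def)
  have esB: "es ! k = B $$ (k,k)" if "k < n" for k
    using dg that w by (auto simp: diag_mat_def)
  have AP: "A * P = P * B"
  proof -
    have "A * P = (P * B * Q) * P" using w by simp
    also have "\<dots> = P * B * (Q * P)"
      by (rule assoc_mult_mat[of _ n n _ n _ n]) (use w in auto)
    also have "\<dots> = P * B" using w by simp
    finally show ?thesis .
  qed
  let ?A = "\<lambda>i j. A $$ (i,j)"
  let ?B = "\<lambda>i j. B $$ (i,j)"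
  let ?p = "\<lambda>k i. P $$ (i,k)"
  have "mv n ?A (?p k) i = (\<Sum>l\<le>k. ?B l k * ?p l i)" if "k < n" "i < n" for k i
  proof -
    have "mv n ?A (?p k) i = (A * P) $$ (i,k)"
      using that A w by (simp add: mv_def scalar_prod_def lessThan_atLeast0)
    also have "\<dots> = (\<Sum>l<n. ?B l k * ?p l i)"
      unfolding AP using that w by (simp add: scalar_prod_def lessThan_atLeast0 mult.commute)
    also have "\<dots> = (\<Sum>l\<le>k. ?B l k * ?p l i)"
      by (rule sum.mono_neutral_right) (use that ut w in \<open>auto simp: upper_triangular_def\<close>)
    finally show ?thesis .
  qed
  moreover have "\<forall>l<n. c l = 0" if c: "\<forall>i<n. (\<Sum>l<n. c l * ?p l i) = 0" for c
  proof (intro allI impI)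
    fix l assume l: "l < n"
    let ?v = "vec n c"
    have "P *\<^sub>v ?v = 0\<^sub>v n"
      by (rule eq_vecI) (use c w in \<open>auto simp: scalar_prod_def lessThan_atLeast0 mult.commute\<close>)
    then have "(Q * P) *\<^sub>v ?v = Q *\<^sub>v 0\<^sub>v n"
      using w assoc_mult_mat_vec[of Q n n P n ?v] by simp
    then have "?v = 0\<^sub>v n" using w by auto
    then show "c l = 0" using l by (metis index_vec index_zero_vec(1))
  qed
  ultimately have "\<exists>f. orthonormal n n f \<and> (\<forall>k<n. \<forall>i<n. mv n ?A (f k) i = ?B k k * f k i) \<and>
    (\<forall>k<n. in_span n n ?p (f k)) \<and> (\<forall>k<n. in_span n n f (?p k))"
    by (intro triangularised_symmetric_eigenbasis) (use sym in auto)
  then show thesis using that len esB by auto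
qed

text \<open>For a square matrix with orthonormal rows the transpose is a two-sided inverse, so the
  columns are orthonormal too. This completeness relation collapses the triple sum.\<close>

lemma orthonormal_parseval:
  assumes "orthonormal n n f"
  shows "ip n x y = (\<Sum>k<n. ip n x (f k) * ip n y (f k))"
proof -
  define F where "F = mat n n (\<lambda>(k,i). f k i)"
  have F: "F \<in> carrier_mat n n" by (simp add: F_def)
  have "F * transpose_mat F = 1\<^sub>m n"
    using assms by (intro eq_matI)
      (auto simp: F_def orthonormal_def ip_def scalar_prod_def lessThan_atLeast0)
  then have "transpose_mat F * F = 1\<^sub>m n"
    using mat_mult_left_right_inverse[OF F] F by simp
  then have comp: "(\<Sum>k<n. f k i * f k j) = (if i = j then 1 else 0)" if "i < n" "j < n" for i j
  proof -
    have "(transpose_mat F * F) $$ (i,j) = (\<Sum>k<n. f k i * f k j)"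
      using that by (simp add: F_def scalar_prod_def lessThan_atLeast0)
    then show ?thesis using \<open>transpose_mat F * F = 1\<^sub>m n\<close> that by simp
  qed
  have "(\<Sum>k<n. ip n x (f k) * ip n y (f k))
      = (\<Sum>k<n. \<Sum>i<n. \<Sum>j<n. x i * y j * (f k i * f k j))"
    unfolding ip_def sum_product by (simp add: mult_ac)
  also have "\<dots> = (\<Sum>i<n. \<Sum>k<n. \<Sum>j<n. x i * y j * (f k i * f k j))"
    by (rule sum.swap)
  also have "\<dots> = (\<Sum>i<n. \<Sum>j<n. \<Sum>k<n. x i * y j * (f k i * f k j))"
    by (rule sum.cong[OF refl]) (rule sum.swap)
  also have "\<dots> = (\<Sum>i<n. \<Sum>j<n. x i * y j * (if i = j then 1 else 0))"
    unfolding sum_distrib_left[symmetric] using comp by (intro sum.cong refl) auto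
  also have "\<dots> = ip n x y" by (simp add: ip_def if_distrib cong: if_cong)
  finally show ?thesis ..
qed

text \<open>In the eigenbasis \<open>A - c\<close> is diagonal with entries \<open>ev k - c\<close>.
  It serves three times: \<open>c = 0\<close> bounds the norm of \<open>A x\<close>,
  \<open>c = \<mu>\<close> treats \<open>u\<close> as an approximate eigenvector, and
  \<open>c = ev 1\<close> locates \<open>y\<close>.\<close>

lemma eigenbasis_residual:
  assumes "orthonormal n n f" and sym: "\<And>i j. i < n \<Longrightarrow> j < n \<Longrightarrow> A i j = A j i"
    and ev: "\<And>k i. k < n \<Longrightarrow> i < n \<Longrightarrow> mv n A (f k) i = ev k * f k i"
  shows "(nrm n (\<lambda>i. mv n A x i - c * x i))\<^sup>2 = (\<Sum>k<n. (ev k - c)\<^sup>2 * (ip n x (f k))\<^sup>2)"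
proof -
  have "ip n (\<lambda>i. mv n A x i - c * x i) (f k) = (ev k - c) * ip n x (f k)" if "k < n" for k
  proof -
    have "ip n (mv n A x) (f k) = ip n x (mv n A (f k))" using sym by (rule ip_mv_symmetric)
    also have "\<dots> = ip n x (\<lambda>i. ev k * f k i)" by (rule ip_cong) (use ev that in auto)
    finally show ?thesis by (simp add: ip_linear algebra_simps)
  qed
  then show ?thesis unfolding nrm_sq
    by (subst orthonormal_parseval[OF assms(1)]) (simp add: power2_eq_square mult_ac)
qed

section \<open>Perturbation of the second eigenvector\<close>

text \<open>Parseval for each row of \<open>M\<close>. The basis need not be related to
  \<open>M\<close>; it will be the eigenbasis of the perturbed matrix \<open>A\<close>.\<close>

lemma eigenbasis_hilbert_schmidt:
  assumes "orthonormal n n f"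
  shows "(\<Sum>k<n. (nrm n (mv n M (f k)))\<^sup>2) = (\<Sum>i<n. \<Sum>j<n. (M i j)\<^sup>2)"
proof -
  have "(\<Sum>k<n. (nrm n (mv n M (f k)))\<^sup>2) = (\<Sum>k<n. \<Sum>i<n. (ip n (M i) (f k))\<^sup>2)"
    by (simp only: nrm_sq ip_self mv_ip)
  also have "\<dots> = (\<Sum>i<n. \<Sum>k<n. (ip n (M i) (f k))\<^sup>2)" by (rule sum.swap)
  also have "\<dots> = (\<Sum>i<n. ip n (M i) (M i))"
    by (subst orthonormal_parseval[OF assms]) (simp add: power2_eq_square)
  also have "\<dots> = (\<Sum>i<n. \<Sum>j<n. (M i j)\<^sup>2)" by (simp add: ip_def power2_eq_square)
  finally show ?thesis .
qed

text \<open>Here \<open>a\<close> stands for \<open>p * s\<close>. The two largest eigenvalues use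
  up most of the Hilbert--Schmidt budget \<open>3 * a^2\<close>, which isolates \<open>ev 1\<close>;
  an argument of Davis--Kahan type then shows that \<open>u\<close> lies almost along
  \<open>f 1\<close>.\<close>

lemma second_eigenvector_perturbation:
  fixes M A :: "nat \<Rightarrow> nat \<Rightarrow> real"
  assumes n: "3 \<le> n" and a: "0 < a" and \<delta>: "0 \<le> \<delta>" "\<delta> \<le> a / 1000"
    and hs: "(\<Sum>i<n. \<Sum>j<n. (M i j)\<^sup>2) \<le> 3 * a\<^sup>2"
    and ones: "1.499 * a * real n \<le> (\<Sum>i<n. \<Sum>j<n. M i j)"
    and Mu: "\<And>i. i < n \<Longrightarrow> mv n M u i = \<mu> * u i" and u: "0 < nrm n u"
    and \<mu>: "0.624 * a \<le> \<mu>" "\<mu> \<le> a"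
    and sym: "\<And>i j. i < n \<Longrightarrow> j < n \<Longrightarrow> A i j = A j i"
    and near: "\<And>x. nrm n (\<lambda>i. mv n A x i - mv n M x i) \<le> \<delta> * nrm n x"
    and on: "orthonormal n n f"
    and ev: "\<And>k i. k < n \<Longrightarrow> i < n \<Longrightarrow> mv n A (f k) i = ev k * f k i"
    and ev_sorted: "\<And>k l. k \<le> l \<Longrightarrow> l < n \<Longrightarrow> \<bar>ev l\<bar> \<le> \<bar>ev k\<bar>"
    and y: "\<And>i. i < n \<Longrightarrow> mv n A y i = ev 1 * y i" "ip n y y = 1" "0 \<le> ip n y u"
  shows "(\<Sum>i<n. (nrm n u * y i - u i)\<^sup>2) \<le> 2 * (nrm n u)\<^sup>2 * (\<delta> / (a / 100))\<^sup>2"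
proof -
  define U where "U = nrm n u"
  have U2: "ip n u u = U\<^sup>2" by (simp add: U_def nrm_sq)
  have f1: "nrm n (f k) = 1" if "k < n" for k
  proof -
    have "(nrm n (f k))\<^sup>2 = 1\<^sup>2" using on that unfolding nrm_sq orthonormal_def by simp
    then show ?thesis by (rule power2_eq_imp_eq) simp_all
  qed
  \<comment> \<open>The budget is known for \<open>M\<close>, not for \<open>A\<close>;
    \<open>b k\<close> passes it on to \<open>ev k\<close> at the cost of one
    \<open>\<delta>\<close>.\<close>
  define b where "b = (\<lambda>k. nrm n (mv n M (f k)))"
  have Af: "nrm n (mv n A (f k)) = \<bar>ev k\<bar>" if "k < n" for k
  proof -
    have "nrm n (mv n A (f k)) = nrm n (\<lambda>i. ev k * f k i)" by (rule nrm_cong) (rule ev[OF that])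
    then show ?thesis using that by (simp add: nrm_scale f1)
  qed
  have ev_b: "\<bar>ev k\<bar> \<le> b k + \<delta>" if "k < n" for k
    using nrm_diff_le[of n "mv n A (f k)" "mv n M (f k)"] near[of "f k"] that
    by (simp add: Af f1 b_def)
  have b_sum: "(\<Sum>k<n. (b k)\<^sup>2) \<le> 3 * a\<^sup>2"
    using eigenbasis_hilbert_schmidt[OF on, of M] hs by (simp add: b_def)
  have b_ge: "c\<^sup>2 \<le> (b k)\<^sup>2" if "k < n" "0 \<le> c" "c + \<delta> \<le> \<bar>ev k\<bar>" for c k
    using ev_b[OF that(1)] that by (intro power_mono) auto

  \<comment> \<open>By Cauchy--Schwarz the all-ones vector is stretched by \<open>M\<close> at least
    by 1.499 a, hence by \<open>A\<close> at least by 1.498 a, and no vector is stretched by more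
    than \<open>\<bar>ev 0\<bar>\<close>.\<close>
  have ev0: "1.498 * a \<le> \<bar>ev 0\<bar>"
  proof -
    let ?e = "\<lambda>_::nat. 1::real"
    define N where "N = nrm n ?e"
    have N2: "N\<^sup>2 = real n" unfolding N_def nrm_sq by (simp add: ip_def)
    then have N0: "0 < N" using n by (metis N_def less_le nrm_nonneg of_nat_0_less_iff
      order_less_le_trans zero_less_numeral power_zero_numeral order.strict_iff_order)
    have "1.499 * a * N * N \<le> (\<Sum>i<n. \<Sum>j<n. M i j)"
      using ones N2 by (simp add: power2_eq_square mult.assoc)
    also have "\<dots> = ip n (mv n M ?e) ?e" by (simp add: ip_def mv_def)
    also have "\<dots> \<le> nrm n (mv n M ?e) * N"
      unfolding N_def using abs_ip_le[of n "mv n M ?e" ?e] by simp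
    finally have M1: "1.499 * a * N \<le> nrm n (mv n M ?e)" using N0 by simp
    have "nrm n (mv n M ?e) \<le> nrm n (mv n A ?e) + nrm n (\<lambda>i. mv n A ?e i - mv n M ?e i)"
      using nrm_diff_le[of n "mv n M ?e" "mv n A ?e"] nrm_diff_commute[of n "mv n M ?e"] by simp
    also have "\<dots> \<le> nrm n (mv n A ?e) + a / 1000 * N"
    proof -
      have "\<delta> * N \<le> a / 1000 * N" using \<delta> N0 by (intro mult_right_mono) auto
      then show ?thesis using near[of ?e] by (simp add: N_def)
    qed
    finally have A1: "1.498 * a * N \<le> nrm n (mv n A ?e)" using M1 by (simp add: algebra_simps)
    have "(nrm n (mv n A ?e))\<^sup>2 = (\<Sum>k<n. (ev k)\<^sup>2 * (ip n ?e (f k))\<^sup>2)"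
      using eigenbasis_residual[OF on sym ev, where c = 0 and x = ?e] by simp
    also have "\<dots> \<le> (\<Sum>k<n. (ev 0)\<^sup>2 * (ip n ?e (f k))\<^sup>2)"
      using ev_sorted[of 0] by (intro sum_mono mult_right_mono) (auto simp: abs_le_square_iff)
    also have "\<dots> = (\<bar>ev 0\<bar> * N)\<^sup>2"
      unfolding sum_distrib_left[symmetric] power_mult_distrib N_def nrm_sq
      by (subst (2) orthonormal_parseval[OF on]) (simp add: power2_eq_square)
    finally have "nrm n (mv n A ?e) \<le> \<bar>ev 0\<bar> * N"
      by (rule power2_le_imp_le) (use N0 in simp)
    then have "1.498 * a * N \<le> \<bar>ev 0\<bar> * N" using A1 by linarith
    then show ?thesis using N0 by simp
  qed

  define g where "g = (\<lambda>k. (ev k - \<mu>)\<^sup>2)"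
  \<comment> \<open>Since \<open>u\<close> is an exact eigenvector of \<open>M\<close>, its residual
    under \<open>A\<close> is pure noise.\<close>
  have resid: "(\<Sum>k<n. g k * (ip n u (f k))\<^sup>2) \<le> \<delta>\<^sup>2 * U\<^sup>2"
  proof -
    have "nrm n (\<lambda>i. mv n A u i - \<mu> * u i) = nrm n (\<lambda>i. mv n A u i - mv n M u i)"
      by (rule nrm_cong) (simp add: Mu)
    also have "\<dots> \<le> \<delta> * U" unfolding U_def by (rule near)
    finally have "(nrm n (\<lambda>i. mv n A u i - \<mu> * u i))\<^sup>2 \<le> (\<delta> * U)\<^sup>2"
      by (intro power_mono) simp_all
    then show ?thesis
      using eigenbasis_residual[OF on sym ev, where x = u and c = \<mu>]
      by (simp add: g_def power_mult_distrib)
  qed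
  have parseval_u: "(\<Sum>k<n. (ip n u (f k))\<^sup>2) = U\<^sup>2"
    unfolding U2[symmetric] by (subst (2) orthonormal_parseval[OF on]) (simp add: power2_eq_square)

  \<comment> \<open>Some eigenvalue of \<open>A\<close> lies within \<open>\<delta>\<close> of
    \<open>\<mu>\<close>, for otherwise every weight \<open>g k\<close> would exceed
    \<open>\<delta>^2\<close> and contradict \<open>resid\<close>. It is not \<open>ev 0\<close>,
    which is too large in modulus, so \<open>\<bar>ev 1\<bar>\<close> is at least 0.624 a - 0.001
    a.\<close>
  have ev1: "0.623 * a \<le> \<bar>ev 1\<bar>"
  proof -
    have "\<exists>k<n. \<bar>ev k - \<mu>\<bar> \<le> \<delta>"
    proof (rule ccontr)
      assume "\<not> ?thesis"
      then have far: "\<delta> < \<bar>ev k - \<mu>\<bar>" if "k < n" for k using that by force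
      have "\<exists>k<n. ip n u (f k) \<noteq> 0"
      proof (rule ccontr)
        assume "\<not> ?thesis"
        then have "U\<^sup>2 = 0" using parseval_u by simp
        then show False using u by (simp add: U_def)
      qed
      then obtain k0 where k0: "k0 < n" "ip n u (f k0) \<noteq> 0" by blast
      have lt: "\<delta>\<^sup>2 < g k" if "k < n" for k
        using power_strict_mono[OF far[OF that], of 2] \<delta> by (simp add: g_def)
      have "(\<Sum>k<n. \<delta>\<^sup>2 * (ip n u (f k))\<^sup>2) < (\<Sum>k<n. g k * (ip n u (f k))\<^sup>2)"
      proof (rule sum_strict_mono_ex1)
        show "\<forall>k\<in>{..<n}. \<delta>\<^sup>2 * (ip n u (f k))\<^sup>2 \<le> g k * (ip n u (f k))\<^sup>2"
          using less_imp_le[OF lt] by (intro ballI mult_right_mono) auto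
        show "\<exists>k\<in>{..<n}. \<delta>\<^sup>2 * (ip n u (f k))\<^sup>2 < g k * (ip n u (f k))\<^sup>2"
          using k0 lt by (intro bexI[of _ k0] mult_strict_right_mono) auto
      qed simp
      then show False using resid parseval_u by (simp flip: sum_distrib_left)
    qed
    then obtain k where k: "k < n" "\<bar>ev k - \<mu>\<bar> \<le> \<delta>" by blast
    have "k \<noteq> 0"
    proof
      assume "k = 0"
      then show False using k ev0 \<mu> \<delta> a by (simp add: abs_if split: if_splits)
    qed
    then have "\<bar>ev k\<bar> \<le> \<bar>ev 1\<bar>" using ev_sorted[of 1 k] k by simp
    then show ?thesis using k \<mu> \<delta> a by (simp add: abs_if split: if_splits)
  qed

  have three: "(b 0)\<^sup>2 + (b 1)\<^sup>2 + (b 2)\<^sup>2 \<le> 3 * a\<^sup>2"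
  proof -
    have "(\<Sum>k\<in>{0,1,2}. (b k)\<^sup>2) \<le> (\<Sum>k<n. (b k)\<^sup>2)"
      using n by (intro sum_mono2) auto
    then show ?thesis using b_sum by simp
  qed
  have b0: "(1.497 * a)\<^sup>2 \<le> (b 0)\<^sup>2" using n a ev0 \<delta> by (intro b_ge) auto
  have b1: "(0.622 * a)\<^sup>2 \<le> (b 1)\<^sup>2" using n a ev1 \<delta> by (intro b_ge) auto
  have squares: "(1.497 * a)\<^sup>2 = 2241009 / 1000000 * a\<^sup>2" "(0.622 * a)\<^sup>2 = 386884 / 1000000 * a\<^sup>2"
    "(0.872 * a)\<^sup>2 = 760384 / 1000000 * a\<^sup>2" "(0.611 * a)\<^sup>2 = 373321 / 1000000 * a\<^sup>2"
    by (simp_all add: power2_eq_square)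
  have a2: "0 < a\<^sup>2" using a by simp
  \<comment> \<open>Numerically, 3 - 1.497^2 = 0.758991 is below 0.872^2, and taking off 0.622^2 as
    well leaves 0.372107, below 0.611^2. The first bound keeps \<open>ev 1\<close> apart from
    \<open>ev 0\<close>, the second keeps all later eigenvalues below \<open>\<mu>\<close>.\<close>
  have "(b 1)\<^sup>2 \<le> (0.872 * a)\<^sup>2"
    using three b0 zero_le_power2[of "b 2"] a2 unfolding squares by linarith
  then have "b 1 \<le> 0.872 * a" by (rule power2_le_imp_le) (use a in simp)
  then have ev1_le: "\<bar>ev 1\<bar> \<le> 0.873 * a" using ev_b[of 1] n \<delta> by simp
  have "(b 2)\<^sup>2 \<le> (0.611 * a)\<^sup>2"
    using three b0 b1 a2 unfolding squares by linarith
  then have "b 2 \<le> 0.611 * a" by (rule power2_le_imp_le) (use a in simp)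
  then have ev2: "\<bar>ev 2\<bar> \<le> 0.612 * a" using ev_b[of 2] n \<delta> by simp
  have ev_ge2: "\<bar>ev k\<bar> \<le> 0.612 * a" if "k < n" "k \<noteq> 0" "k \<noteq> 1" for k
    using ev_sorted[of 2 k] that ev2 by simp
  \<comment> \<open>The margins are 1.498 - 1 towards \<open>ev 0\<close> and 0.624 - 0.612 towards
    the later eigenvalues; both exceed 1/100.\<close>
  have gap: "(a / 100)\<^sup>2 \<le> g k" if "k < n" "k \<noteq> 1" for k
  proof -
    have "a / 100 \<le> \<bar>ev k - \<mu>\<bar>"
    proof (cases "k = 0")
      case True then show ?thesis using ev0 \<mu> a by (simp add: abs_if split: if_splits)
    next
      case False then show ?thesis using ev_ge2[OF that(1) False that(2)] \<mu> a
        by (simp add: abs_if split: if_splits)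
    qed
    from power_mono[OF this, of 2] show ?thesis using a by (simp add: g_def)
  qed
  have ev_ne: "ev k \<noteq> ev 1" if "k < n" "k \<noteq> 1" for k
    using ev0 ev1 ev1_le a ev_ge2[OF that(1) _ that(2)] by (cases "k = 0") auto

  \<comment> \<open>The residual of \<open>y\<close> at \<open>ev 1\<close> is zero and
    \<open>ev 1\<close> is a simple eigenvalue, so only the coordinate along \<open>f 1\<close>
    survives: \<open>y\<close> is \<open>f 1\<close> up to sign.\<close>
  have yf: "ip n y (f k) = 0" if "k < n" "k \<noteq> 1" for k
  proof -
    have "(\<Sum>k<n. (ev k - ev 1)\<^sup>2 * (ip n y (f k))\<^sup>2) = (nrm n (\<lambda>i. mv n A y i - ev 1 * y i))\<^sup>2"
      by (rule eigenbasis_residual[OF on sym ev, symmetric])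
    also have "\<dots> = 0" using y(1) by (simp add: nrm_sq ip_self_eq_0_iff)
    finally have "\<forall>k\<in>{..<n}. (ev k - ev 1)\<^sup>2 * (ip n y (f k))\<^sup>2 = 0"
      by (subst (asm) sum_nonneg_eq_0_iff) auto
    then show ?thesis using that ev_ne by auto
  qed
  have only1: "(\<Sum>k<n. ip n y (f k) * h k) = ip n y (f 1) * h 1" for h
  proof -
    have "(\<Sum>k<n. ip n y (f k) * h k) = (\<Sum>k\<in>{1}. ip n y (f k) * h k)"
      by (rule sum.mono_neutral_right) (use n yf in auto)
    then show ?thesis by simp
  qed
  have y1: "(ip n y (f 1))\<^sup>2 = 1"
    using y(2) orthonormal_parseval[OF on, of y y] only1[of "\<lambda>k. ip n y (f k)"]
    by (simp add: power2_eq_square)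
  define c where "c = ip n y u"
  have "c = ip n y (f 1) * ip n u (f 1)"
    unfolding c_def by (subst orthonormal_parseval[OF on]) (rule only1)
  then have c2: "c\<^sup>2 = (ip n u (f 1))\<^sup>2" using y1 by (simp add: power_mult_distrib)
  \<comment> \<open>\<open>U^2 - c^2\<close> is the squared length of the part of \<open>u\<close>
    orthogonal to \<open>y\<close>; each of its coordinates enters the residual with weight at least
    \<open>(a / 100)^2\<close>.\<close>
  have "(a / 100)\<^sup>2 * (U\<^sup>2 - c\<^sup>2) \<le> \<delta>\<^sup>2 * U\<^sup>2"
  proof -
    have eq: "{..<n} = insert 1 ({..<n} - {1})" using n by auto
    have "U\<^sup>2 - c\<^sup>2 = (\<Sum>k\<in>{..<n}-{1}. (ip n u (f k))\<^sup>2)"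
      using n unfolding parseval_u[symmetric] c2 by (subst eq, subst sum.insert) auto
    then have "(a / 100)\<^sup>2 * (U\<^sup>2 - c\<^sup>2) \<le> (\<Sum>k\<in>{..<n}-{1}. g k * (ip n u (f k))\<^sup>2)"
      using gap by (auto simp: sum_distrib_left intro!: sum_mono mult_right_mono)
    also have "\<dots> \<le> (\<Sum>k<n. g k * (ip n u (f k))\<^sup>2)"
      by (rule sum_mono2) (auto simp: g_def)
    finally show ?thesis using resid by simp
  qed
  then have c_close: "U\<^sup>2 - c\<^sup>2 \<le> U\<^sup>2 * (\<delta> / (a / 100))\<^sup>2"
    using a by (simp add: power_divide field_simps)
  have "c \<le> U" using abs_ip_le[of n y u] y(2)
    by (simp add: c_def U_def nrm_def L2_set_def ip_def power2_eq_square)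
  \<comment> \<open>The sign choice \<open>0 \<le> c\<close> enters here: from
    \<open>c^2 \<le> U * c\<close> the squared distance \<open>2 * U^2 - 2 * (U * c)\<close> is at
    most \<open>2 * (U^2 - c^2)\<close>.\<close>
  then have "c * c \<le> U * c" using y(3) by (intro mult_right_mono) (simp_all add: c_def)
  moreover have "(\<Sum>i<n. (U * y i - u i)\<^sup>2) = 2 * U\<^sup>2 - 2 * (U * c)"
  proof -
    have "(\<Sum>i<n. (U * y i - u i)\<^sup>2) = ip n (\<lambda>i. U * y i - u i) (\<lambda>i. U * y i - u i)"
      by (simp add: ip_def power2_eq_square)
    also have "\<dots> = 2 * U\<^sup>2 - 2 * (U * c)"
      unfolding ip_linear by (simp add: U2 y(2) c_def ip_commute[of n u y] power2_eq_square algebra_simps)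
    finally show ?thesis .
  qed
  ultimately show ?thesis using c_close unfolding U_def[symmetric] by (simp add: power2_eq_square[of c])
qed

section \<open>Kendall distance\<close>

text \<open>Jordan's inequality: a concave function lies above its chord.\<close>

lemma sin_ge_chord:
  assumes "0 \<le> x" "x \<le> pi / 2"
  shows "2 * x / pi \<le> sin x"
proof -
  have "convex_on {0..pi/2} (\<lambda>x. - sin x)"
  proof (rule f''_ge0_imp_convex)
    show "((\<lambda>x. - sin x) has_real_derivative - cos x) (at x)" for x :: real
      by (auto intro!: derivative_eq_intros)
    show "((\<lambda>x. - cos x) has_real_derivative sin x) (at x)" for x :: real
      by (auto intro!: derivative_eq_intros)
    show "0 \<le> sin x" if "x \<in> {0..pi/2}" for x using that by (intro sin_ge_zero) auto
  qed simp
  from convex_onD[OF this, of "2 * x / pi" 0 "pi / 2"] show ?thesis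
    using assms by (simp add: field_simps)
qed

text \<open>The difference is 2 sin((a+b)/2) sin((b-a)/2). Since (a+b)/2 lies between (b-a)/2 and pi
  - (b-a)/2, the first sine is at least the second, and Jordan's inequality bounds both below. The
  quadratic order reflects the flatness of the cosine at 0 and pi.\<close>

lemma cos_diff_ge:
  assumes "0 \<le> a" "a \<le> b" "b \<le> pi"
  shows "2 * ((b - a) / pi)\<^sup>2 \<le> cos a - cos b"
proof -
  have chord: "(b - a) / pi \<le> sin ((b - a) / 2)"
    using sin_ge_chord[of "(b - a) / 2"] assms
    by (simp add: divide_simps split: if_splits)
  have "sin ((b - a) / 2) \<le> sin ((a + b) / 2)"
  proof (cases "(a + b) / 2 \<le> pi / 2")
    case True
    then show ?thesis using assms by (intro sin_monotone_2pi_le) auto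
  next
    case False
    have "sin ((b - a) / 2) \<le> sin (pi - (a + b) / 2)"
      using False assms by (intro sin_monotone_2pi_le) (auto simp: field_simps)
    then show ?thesis by simp
  qed
  moreover have "0 \<le> sin ((a + b) / 2)" using assms by (intro sin_ge_zero) auto
  ultimately have "(b - a) / pi * ((b - a) / pi) \<le> sin ((a + b) / 2) * sin ((b - a) / 2)"
    using assms chord by (intro mult_mono) auto
  then show ?thesis by (simp add: cos_diff_cos power2_eq_square)
qed

text \<open>By cos(pi - x) = - cos x both halves of \<open>u\<close> sample one cosine. With t = pi
  / (4 s + 2) the angles are the odd multiples of t in [0, pi], except that (2 s + 1) t = pi / 2,
  where the cosine vanishes, is left out.\<close>

lemma u_fun_cos:
  assumes "1 \<le> j" "j \<le> 2 * s"
  shows "u_fun s j = cos ((if j \<le> s then 2 * real j - 1 else 2 * real j + 1) * (pi / (4 * real s + 2)))"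
proof (cases "j \<le> s")
  case False
  let ?t = "pi / (4 * real s + 2)"
  have "(2 * real (2 * s - j + 1) - 1) * pi / (4 * real s + 2) = pi - (2 * real j + 1) * ?t"
    using assms by (simp add: of_nat_diff field_simps)
  then show ?thesis using False unfolding u_fun_def by simp
qed (simp add: u_fun_def)

text \<open>The angles stay in [0, pi] and grow by at least 2 t per index, so
  \<open>cos_diff_ge\<close> applies; 2 t / pi gives the denominator 2 s + 1.\<close>

lemma u_fun_gap:
  assumes "1 \<le> i" "i < j" "j \<le> 2 * s"
  shows "2 * ((real j - real i) / (2 * real s + 1))\<^sup>2 \<le> u_fun s i - u_fun s j"
proof -
  define t where "t = pi / (4 * real s + 2)"
  have t: "0 < t" "(4 * real s + 2) * t = pi" by (simp_all add: t_def add_pos_nonneg field_simps)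
  define ang where "ang = (\<lambda>j. (if j \<le> s then 2 * real j - 1 else 2 * real j + 1) * t)"
  have lo: "0 \<le> ang i" using assms t by (simp add: ang_def)
  have step: "2 * (real j - real i) * t \<le> ang j - ang i"
    using assms t unfolding ang_def left_diff_distrib[symmetric] by (intro mult_right_mono) auto
  have "ang j \<le> (4 * real s + 2) * t"
    using assms t unfolding ang_def by (intro mult_right_mono) auto
  then have hi: "ang j \<le> pi" using t by simp
  have pos: "0 \<le> 2 * (real j - real i) * t" using assms t by simp
  have "(real j - real i) / (2 * real s + 1) = 2 * (real j - real i) * t / pi"
    using t(1) unfolding t(2)[symmetric] by (simp add: divide_simps) (simp add: algebra_simps)
  also have "\<dots> \<le> (ang j - ang i) / pi" using step by (simp add: divide_right_mono)
  finally have "((real j - real i) / (2 * real s + 1))\<^sup>2 \<le> ((ang j - ang i) / pi)\<^sup>2"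
    using assms by (intro power_mono) auto
  moreover have "2 * ((ang j - ang i) / pi)\<^sup>2 \<le> cos (ang i) - cos (ang j)"
    using lo step pos hi by (intro cos_diff_ge) auto
  ultimately show ?thesis
    using u_fun_cos[of i s] u_fun_cos[of j s] assms by (simp add: ang_def t_def)
qed

text \<open>A pair inverted by \<open>z\<close> either contains an index where \<open>z\<close> and \<open>u\<close> differ by at least \<open>\<tau>\<close>
  (at most \<open>K / \<tau>\<^sup>2\<close> indices), or is at distance \<open>O(n \<tau>\<^sup>1\<^sup>/\<^sup>2)\<close>; the two contributions balance
  at \<open>\<tau> = n powr (-2/5)\<close>.\<close>

lemma kendall_le_of_l2_close:
  assumes n: "1 \<le> n" and K: "0 \<le> K"
    and gap: "\<And>i j. i < j \<Longrightarrow> j < n \<Longrightarrow> 2 * ((real j - real i) / (real n + 1))\<^sup>2 \<le> u i - u j"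
    and close: "(\<Sum>i<n. (z i - u i)\<^sup>2) \<le> K"
    and perm: "\<sigma> permutes {..<n}"
    and sorted: "\<And>i j. i < j \<Longrightarrow> j < n \<Longrightarrow> z (\<sigma> j) \<le> z (\<sigma> i)"
  shows "real (kendall n \<sigma>) \<le> (2 * K + 2) * real n powr (9/5)"
proof -
  define \<tau> where "\<tau> = real n powr (-2/5)"
  have \<tau>: "0 < \<tau>" "\<tau>\<^sup>2 = real n powr (-4/5)" "sqrt \<tau> = real n powr (-1/5)"
    using n by (auto simp: \<tau>_def powr_powr powr_half_sqrt[symmetric] simp flip: powr_numeral)
  define T where "T = {i. i < n \<and> \<tau> \<le> \<bar>z i - u i\<bar>}"
  define L where "L = nat \<lfloor>(real n + 1) * sqrt \<tau>\<rfloor>"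
  \<comment> \<open>An inversion \<open>(i,j)\<close> is recorded as the pair of indices
    \<open>(\<sigma> j, \<sigma> i)\<close>, which \<open>u\<close> orders strictly and
    \<open>z\<close> orders the other way or ties.\<close>
  define S where "S = {(a,b). a < b \<and> b < n \<and> z a \<le> z b}"
  have finT: "finite T" unfolding T_def by simp
  have "real (card T) * \<tau>\<^sup>2 = (\<Sum>i\<in>T. \<tau>\<^sup>2)" by simp
  also have "\<dots> \<le> (\<Sum>i\<in>T. (z i - u i)\<^sup>2)"
  proof (rule sum_mono)
    fix i assume "i \<in> T"
    then have "\<tau>\<^sup>2 \<le> \<bar>z i - u i\<bar>\<^sup>2" using \<tau> by (intro power_mono) (auto simp: T_def)
    then show "\<tau>\<^sup>2 \<le> (z i - u i)\<^sup>2" by simp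
  qed
  also have "\<dots> \<le> (\<Sum>i<n. (z i - u i)\<^sup>2)"
    by (rule sum_mono2) (auto simp: T_def)
  also have "\<dots> \<le> K" by (rule close)
  finally have "real (card T) \<le> K / \<tau>\<^sup>2" using \<tau>(1) by (simp add: pos_le_divide_eq)
  also have "\<dots> = K * real n powr (4/5)" unfolding \<tau> by (simp add: powr_minus_divide)
  finally have cT: "real (card T) \<le> K * real n powr (4/5)" .
  have Sub: "S \<subseteq> T \<times> {..<n} \<union> {..<n} \<times> T \<union> (SIGMA a:{..<n}. {a<..a + L})"
  proof
    fix x assume "x \<in> S"
    then obtain a b where x: "x = (a,b)" and ab: "a < b" "b < n" "z a \<le> z b"
      by (auto simp: S_def)
    show "x \<in> T \<times> {..<n} \<union> {..<n} \<times> T \<union> (SIGMA a:{..<n}. {a<..a + L})"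
    proof (cases "a \<in> T \<or> b \<in> T")
      case True then show ?thesis using x ab by auto
    next
      case False
      \<comment> \<open>Both errors are below \<open>\<tau>\<close>, and
        \<open>z a \<le> z b\<close>, so the two errors together bound the drop of
        \<open>u\<close>.\<close>
      then have "u a - u b \<le> 2 * \<tau>" using ab by (auto simp: T_def)
      then have "((real b - real a) / (real n + 1))\<^sup>2 \<le> \<tau>"
        using gap[OF ab(1,2)] by simp
      then have "(real b - real a) / (real n + 1) \<le> sqrt \<tau>"
        by (rule real_le_rsqrt)
      then have "real (b - a) \<le> (real n + 1) * sqrt \<tau>"
        using ab by (simp add: field_simps of_nat_diff)
      then have "b - a \<le> L" unfolding L_def by (simp add: le_nat_floor)
      then show ?thesis using x ab by auto
    qed
  qed
  have "finite S" by (rule finite_subset[of _ "{..<n} \<times> {..<n}"]) (auto simp: S_def)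
  have inj: "inj_on (\<lambda>(i,j). (\<sigma> j, \<sigma> i)) {(i,j). i < j \<and> j < n \<and> \<sigma> j < \<sigma> i}"
    using permutes_inj[OF perm] by (auto simp: inj_on_def dest: injD)
  have "(\<lambda>(i,j). (\<sigma> j, \<sigma> i)) ` {(i,j). i < j \<and> j < n \<and> \<sigma> j < \<sigma> i} \<subseteq> S"
  proof -
    have "\<sigma> i < n" if "i < n" for i using permutes_in_image[OF perm, of i] that by simp
    then show ?thesis unfolding S_def using sorted by fastforce
  qed
  then have "kendall n \<sigma> \<le> card S"
    unfolding kendall_def by (rule card_inj_on_le[OF inj _ \<open>finite S\<close>])
  also have "\<dots> \<le> card (T \<times> {..<n} \<union> {..<n} \<times> T \<union> (SIGMA a:{..<n}. {a<..a + L}))"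
    by (rule card_mono[OF _ Sub]) (use finT in auto)
  also have "\<dots> \<le> card (T \<times> {..<n}) + card ({..<n} \<times> T) + card (SIGMA a:{..<n}. {a<..a + L})"
    by (meson add_right_mono card_Un_le order_trans)
  also have "\<dots> = 2 * (card T * n) + n * L" by (simp add: card_cartesian_product)
  finally have "real (kendall n \<sigma>) \<le> 2 * (real (card T) * real n) + real n * real L"
    by (metis (mono_tags) of_nat_add of_nat_le_iff of_nat_mult of_nat_numeral)
  also have "\<dots> \<le> 2 * (K * real n powr (4/5) * real n) + real n * (2 * real n * real n powr (-1/5))"
  proof -
    have "real L \<le> (real n + 1) * sqrt \<tau>" unfolding L_def using \<tau> by (intro of_nat_floor) simp
    also have "\<dots> \<le> 2 * real n * sqrt \<tau>" using n \<tau> by (intro mult_right_mono) auto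
    finally have "real L \<le> 2 * real n * real n powr (-1/5)" unfolding \<tau> .
    then show ?thesis using cT by (intro add_mono mult_left_mono mult_right_mono) auto
  qed
  also have "\<dots> = (2 * K + 2) * real n powr (9/5)"
  proof -
    have "real n powr (4/5) * real n = real n powr (9/5)"
      using n powr_add[of "real n" "4/5" 1] by simp
    moreover have "real n * (real n * real n powr (-1/5)) = real n powr (9/5)"
      using n powr_add[of "real n" "2" "-1/5"] by (simp add: power2_eq_square)
    ultimately show ?thesis by (simp add: algebra_simps)
  qed
  finally show ?thesis .
qed

section \<open>The band matrix\<close>

text \<open>The condition \<bar>i - j\<bar> \<le> s - 1 is written without subtraction of naturals,
  and it makes sense for all indices, so symmetry and the zero diagonal hold
  unconditionally.\<close>

definition band :: "real \<Rightarrow> nat \<Rightarrow> nat \<Rightarrow> nat \<Rightarrow> real" where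
  "band p s i j = (if i \<noteq> j \<and> i < j + s \<and> j < i + s then p else 0)"

lemma band_M_index:
  assumes "1 \<le> s" "i < 2 * s" "j < 2 * s"
  shows "band_M p s $$ (i,j) = band p s i j"
  using assms by (auto simp: band_M_def band_def Let_def)

text \<open>A row is a window of consecutive columns with its diagonal entry removed. Truncated
  subtraction clips the window on the left, \<open>min\<close> on the right.\<close>

lemma mv_band:
  assumes "1 \<le> s" "i < 2 * s"
  shows "mv (2 * s) (band p s) x i = p * ((\<Sum>j\<in>{i+1-s..<min (2 * s) (i+s)}. x j) - x i)"
proof -
  have "mv (2 * s) (band p s) x i = (\<Sum>j\<in>{i+1-s..<min (2 * s) (i+s)} - {i}. p * x j)"
    unfolding mv_def by (rule sum.mono_neutral_cong_right) (auto simp: band_def)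
  also have "\<dots> = p * ((\<Sum>j\<in>{i+1-s..<min (2 * s) (i+s)}. x j) - x i)"
    unfolding sum_distrib_left[symmetric] using assms by (subst sum_diff1) auto
  finally show ?thesis .
qed

section \<open>Entry sum and Hilbert--Schmidt norm of the band matrix\<close>

lemma sum_lessThan_double:
  fixes f :: "nat \<Rightarrow> real"
  shows "(\<Sum>i<2 * s. f i) = (\<Sum>i<s. f i) + (\<Sum>i<s. f (s + i))"
proof -
  have "(\<Sum>i<s+m. f i) = (\<Sum>i<s. f i) + (\<Sum>i<m. f (s + i))" for m
    by (induction m) simp_all
  from this[of s] show ?thesis by (simp add: mult_2)
qed

lemma sum_of_nat_lessThan: "(\<Sum>i<n. real i) = real n * (real n - 1) / 2"
  by (induction n) (auto simp: field_simps)

text \<open>Row \<open>i\<close> of the upper half has i + s - 1 band entries, row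
  \<open>s + i\<close> has 2 s - 2 - i. As entries are 0 or \<open>p\<close>, the same count gives
  the Hilbert--Schmidt norm.\<close>

lemma band_sum:
  assumes "1 \<le> s"
  shows "(\<Sum>i<2 * s. \<Sum>j<2 * s. band p s i j) = 3 * p * real s * (real s - 1)"
proof -
  have row: "(\<Sum>j<2 * s. band p s i j) = p * (real (min (2 * s) (i+s) - (i+1-s)) - 1)" if "i < 2 * s" for i
    using mv_band[OF assms that, of p "\<lambda>_. 1"] by (simp add: mv_def)
  have "(\<Sum>i<s. \<Sum>j<2 * s. band p s i j) = (\<Sum>i<s. p * (real i + (real s - 1)))"
    by (intro sum.cong refl, subst row) auto
  moreover have "(\<Sum>i<s. \<Sum>j<2 * s. band p s (s+i) j) = (\<Sum>i<s. p * ((2 * real s - 2) - real i))"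
    by (intro sum.cong refl, subst row) (auto simp: of_nat_diff)
  ultimately show ?thesis
    unfolding sum_lessThan_double[of "\<lambda>i. \<Sum>j<2 * s. band p s i j"]
    by (simp add: sum_distrib_left[symmetric] sum.distrib sum_subtractf sum_of_nat_lessThan field_simps)
qed

lemma band_hilbert_schmidt:
  assumes "1 \<le> s"
  shows "(\<Sum>i<2 * s. \<Sum>j<2 * s. (band p s i j)\<^sup>2) = 3 * p\<^sup>2 * real s * (real s - 1)"
proof -
  have sq: "(band p s i j)\<^sup>2 = p * band p s i j" for i j by (simp add: band_def power2_eq_square)
  show ?thesis unfolding sq sum_distrib_left[symmetric] band_sum[OF assms]
    by (simp add: power2_eq_square)
qed

text \<open>The eigenvalue of \<open>u\<close>: a window sum of \<open>u\<close> is the central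
  entry times 1 / (2 sin t), and the -1 removes the diagonal.\<close>

definition band_eigenvalue :: "real \<Rightarrow> nat \<Rightarrow> real" where
  "band_eigenvalue p s = p * (1 / (2 * sin (pi / (4 * real s + 2))) - 1)"

lemma u_fun_partial_sum:
  defines "t \<equiv> \<lambda>s. pi / (4 * real s + 2)"
  assumes "k \<le> 2 * s"
  shows "2 * sin (t s) * (\<Sum>j<k. u_fun s (j + 1)) = sin ((if k \<le> s then 2 * real k else 2 * real k + 2) * t s)"
  using assms(2)
proof (induction k)
  case (Suc k)
  let ?t = "t s"
  \<comment> \<open>This identity telescopes the cosine sum within each half.\<close>
  have tel: "2 * sin ?t * cos x = sin (x + ?t) - sin (x - ?t)" for x
    by (simp add: sin_add sin_diff)
  have IH: "2 * sin ?t * (\<Sum>j<k. u_fun s (j + 1)) = sin ((if k \<le> s then 2 * real k else 2 * real k + 2) * ?t)"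
    using Suc by simp
  have sum: "2 * sin ?t * (\<Sum>j<Suc k. u_fun s (j + 1))
      = sin ((if k \<le> s then 2 * real k else 2 * real k + 2) * ?t) + 2 * sin ?t * u_fun s (k + 1)"
    by (simp only: sum.lessThan_Suc distrib_left IH)
  show ?case
  proof (cases "k < s")
    case True
    then have u: "u_fun s (k + 1) = cos ((2 * real k + 1) * ?t)"
      using u_fun_cos[of "k+1" s] Suc.prems by (simp add: t_def algebra_simps)
    have "(2 * real k + 1) * ?t + ?t = (2 * real k + 2) * ?t" "(2 * real k + 1) * ?t - ?t = 2 * real k * ?t"
      by (simp_all add: algebra_simps)
    moreover have "(if Suc k \<le> s then 2 * real (Suc k) else 2 * real (Suc k) + 2) = 2 * real k + 2"
      "(if k \<le> s then 2 * real k else 2 * real k + 2) = 2 * real k"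
      using True by simp_all
    ultimately show ?thesis unfolding sum u by (simp only: tel)
  next
    case False
    then have u: "u_fun s (k + 1) = cos ((2 * real k + 3) * ?t)"
      using u_fun_cos[of "k+1" s] Suc.prems by (simp add: t_def algebra_simps)
    have "sin ((if k \<le> s then 2 * real k else 2 * real k + 2) * ?t) = sin ((2 * real k + 2) * ?t)"
    proof (cases "k = s")
      case True
      \<comment> \<open>The jump in the angles between the halves does no harm: 2 s t and (2 s + 2)
        t add up to pi and have equal sines.\<close>
      have "(2 * real s + 2) * ?t = pi - 2 * real s * ?t" by (simp add: t_def field_simps)
      then show ?thesis using True by simp
    qed (use False in simp)
    moreover have "(2 * real k + 3) * ?t + ?t = (2 * real k + 4) * ?t" "(2 * real k + 3) * ?t - ?t = (2 * real k + 2) * ?t"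
      by (simp_all add: algebra_simps)
    moreover have "(if Suc k \<le> s then 2 * real (Suc k) else 2 * real (Suc k) + 2) = 2 * real k + 4"
      using False by simp
    ultimately show ?thesis unfolding sum u by (simp only: tel)
  qed
qed simp

text \<open>One end of each window is clipped at a boundary where the partial sum \<open>S\<close>
  vanishes; the other end lies a quarter period away from the angle of entry \<open>i\<close>, which
  turns the sine into the required cosine.\<close>

lemma mv_band_u:
  assumes "1 \<le> s" "i < 2 * s"
  shows "mv (2 * s) (band p s) (\<lambda>j. u_fun s (j + 1)) i = band_eigenvalue p s * u_fun s (i + 1)"
proof -
  define t where "t = pi / (4 * real s + 2)"
  have t: "0 < t" "(2 * real s + 1) * t = pi / 2" by (simp_all add: t_def add_pos_nonneg field_simps)
  have "t < pi" using t(2) assms(1) pi_gt_zero t(1)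
    by (simp add: t_def divide_less_eq add_pos_nonneg)
  with t have sn: "0 < sin t" by (intro sin_gt_zero) auto
  define S where "S = (\<lambda>k. \<Sum>j<k. u_fun s (j + 1))"
  have Sk: "2 * sin t * S k = sin ((if k \<le> s then 2 * real k else 2 * real k + 2) * t)" if "k \<le> 2 * s" for k
    using u_fun_partial_sum[OF that] by (simp add: S_def t_def)
  have win: "(\<Sum>j\<in>{i+1-s..<min (2 * s) (i+s)}. u_fun s (j + 1)) = S (min (2 * s) (i+s)) - S (i+1-s)"
    unfolding S_def lessThan_atLeast0 using assms by (subst sum_diff_nat_ivl) auto
  have "2 * sin t * (S (min (2 * s) (i+s)) - S (i+1-s)) = u_fun s (i + 1)"
  proof (cases "i < s")
    case True
    \<comment> \<open>For \<open>i = 0\<close> the window ends exactly at the middle, where the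
      first-half formula applies; supplementary angles reconcile it with the second-half
      formula.\<close>
    have "sin ((if i + s \<le> s then 2 * real (i+s) else 2 * real (i+s) + 2) * t) = sin ((2 * real i + 1) * t + pi / 2)"
    proof (cases "i = 0")
      case True
      have "2 * real s * t = pi - ((2 * real i + 1) * t + pi / 2)"
        using True t(2) by (simp add: algebra_simps)
      then show ?thesis using True by (simp add: sin_add sin_diff)
    next
      case False
      have "(2 * real (i+s) + 2) * t = (2 * real i + 1) * t + pi / 2"
        using t(2) by (simp add: algebra_simps)
      then show ?thesis using False by simp
    qed
    then have "2 * sin t * S (i + s) = cos ((2 * real i + 1) * t)"
      using Sk[of "i+s"] True by (simp add: sin_add)
    moreover have "u_fun s (i + 1) = cos ((2 * real i + 1) * t)"
      using u_fun_cos[of "i+1" s] True by (simp add: t_def algebra_simps)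
    ultimately show ?thesis using True by (simp add: S_def right_diff_distrib)
  next
    case False
    have "(2 * real (2 * s) + 2) * t = pi" using t(2) by (simp add: algebra_simps)
    then have "2 * sin t * S (2 * s) = 0" using Sk[of "2 * s"] assms by simp
    moreover have "2 * sin t * S (i + 1 - s) = - cos ((2 * real i + 3) * t)"
    proof -
      have "2 * real (i+1-s) * t = (2 * real i + 3) * t - pi / 2"
        using t(2) False by (simp add: of_nat_diff algebra_simps)
      moreover have "i + 1 - s \<le> s" using assms by simp
      ultimately show ?thesis using Sk[of "i+1-s"] False by (simp add: sin_diff)
    qed
    moreover have "u_fun s (i + 1) = cos ((2 * real i + 3) * t)"
      using u_fun_cos[of "i+1" s] False assms by (simp add: t_def algebra_simps)
    ultimately show ?thesis using False assms by (simp add: right_diff_distrib min_def)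
  qed
  then have "S (min (2 * s) (i+s)) - S (i+1-s) = u_fun s (i + 1) / (2 * sin t)"
    using sn by (simp add: field_simps)
  then show ?thesis unfolding mv_band[OF assms] win band_eigenvalue_def t_def[symmetric]
    by (simp add: algebra_simps)
qed

text \<open>Machin's formula with arctan(1/5) \<le> 1/5. The value is chosen for 2 / (16/5) =
  0.625.\<close>

lemma pi_le_16_5: "pi \<le> 16 / 5"
proof -
  have "0 \<le> arctan (1/239 :: real)" by simp
  moreover have "arctan (1/5 :: real) \<le> 1/5" by (rule arctan_le_self) simp
  ultimately show ?thesis using machin by linarith
qed

text \<open>The lower bound comes from sin t \<le> t and the bound on pi, the upper one from
  Jordan's inequality, which gives 1 / (2 sin t) \<le> s + 1/2.\<close>

lemma band_eigenvalue_bounds: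
  assumes "1 \<le> s" "0 < p"
  shows "p * (0.625 * real s - 1) \<le> band_eigenvalue p s" "band_eigenvalue p s \<le> p * real s"
proof -
  define t where "t = pi / (4 * real s + 2)"
  have t: "0 < t" by (simp add: t_def add_pos_nonneg)
  have "pi * 2 \<le> pi * (4 * real s + 2)" by (intro mult_left_mono) auto
  then have t2: "t \<le> pi / 2" by (simp add: t_def field_simps)
  have lo: "1 / (2 * real s + 1) \<le> sin t"
  proof -
    have "2 * t / pi = 1 / (2 * real s + 1)"
      by (simp add: t_def divide_simps add_nonneg_eq_0_iff)
    then show ?thesis using sin_ge_chord[of t] t t2 by simp
  qed
  then have sn: "0 < sin t" by (rule less_le_trans[rotated]) (simp add: add_pos_nonneg)
  have "sin t \<le> t" using t by (intro sin_x_le_x) simp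
  also have "\<dots> \<le> (16/5) / (4 * real s + 2)"
    unfolding t_def using pi_le_16_5 by (intro divide_right_mono) auto
  finally have "sin t * (4 * real s + 2) \<le> 16/5"
    by (rule iffD1[OF pos_le_divide_eq, rotated]) (simp add: add_pos_nonneg)
  then have "0.625 * real s \<le> 1 / (2 * sin t)" using sn by (simp add: field_simps)
  then show "p * (0.625 * real s - 1) \<le> band_eigenvalue p s"
    unfolding band_eigenvalue_def t_def[symmetric] using assms by (intro mult_left_mono) auto
  have "1 / (2 * sin t) \<le> (2 * real s + 1) / 2"
    using lo sn by (simp add: divide_simps split: if_splits) (simp add: algebra_simps)
  then show "band_eigenvalue p s \<le> p * real s"
    unfolding band_eigenvalue_def t_def[symmetric] using assms by (intro mult_left_mono) auto
qed

section \<open>Operator norm of the noise\<close>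

text \<open>Each summand ranges over an interval of length \<open>\<bar>c e\<bar>\<close>; the
  normalisation of the squared coefficients to at most 2 reduces Hoeffding's exponent to
  \<open>- t^2\<close>.\<close>

lemma hoeffding_Pi_bernoulli:
  fixes c q :: "'a \<Rightarrow> real"
  assumes I: "finite I" and q: "\<And>e. e \<in> I \<Longrightarrow> 0 \<le> q e \<and> q e \<le> 1"
    and V: "(\<Sum>e\<in>I. (c e)\<^sup>2) \<le> 2" and t: "0 < t"
  shows "measure_pmf.prob (Pi_pmf I False (\<lambda>e. bernoulli_pmf (q e)))
    {b. t \<le> (\<Sum>e\<in>I. c e * (of_bool (b e) - q e))} \<le> exp (- t\<^sup>2)"
proof (cases "(\<Sum>e\<in>I. (c e)\<^sup>2) = 0")
  \<comment> \<open>With all coefficients zero the exponent would have denominator 0; the event is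
    then empty.\<close>
  case True
  then have "\<forall>e\<in>I. c e = 0" using I by (simp add: sum_nonneg_eq_0_iff)
  then have "{b. t \<le> (\<Sum>e\<in>I. c e * (of_bool (b e) - q e))} = {}" using t by simp
  then show ?thesis by simp
next
  case False
  then have pos: "0 < (\<Sum>e\<in>I. (c e)\<^sup>2)" by (simp add: sum_nonneg order_less_le)
  define P where "P = Pi_pmf I False (\<lambda>e. bernoulli_pmf (q e))"
  define X where "X = (\<lambda>e b. c e * (of_bool (b e) :: real))"
  have mean: "measure_pmf.expectation P (X e) = c e * q e" if "e \<in> I" for e
  proof -
    have "measure_pmf.expectation P (X e)
        = measure_pmf.expectation (map_pmf (\<lambda>b. b e) P) (\<lambda>v. c e * of_bool v)"
      by (simp add: X_def)
    also have "map_pmf (\<lambda>b. b e) P = bernoulli_pmf (q e)"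
      unfolding P_def using I that by (simp add: Pi_pmf_component)
    finally show ?thesis using q[OF that] by simp
  qed
  have indep: "prob_space.indep_vars (measure_pmf P) (\<lambda>_. borel) X I"
    unfolding X_def P_def
    by (rule prob_space.indep_vars_compose2[OF measure_pmf.prob_space_axioms indep_vars_Pi_pmf[OF I]]) simp
  have mean_sum: "(\<Sum>e\<in>I. c e * q e) = (\<Sum>e\<in>I. measure_pmf.expectation P (X e))"
    by (intro sum.cong refl) (simp add: mean)
  interpret Hoeffding_ineq "measure_pmf P" I X "\<lambda>e. min 0 (c e)" "\<lambda>e. max 0 (c e)" "\<Sum>e\<in>I. c e * q e"
  proof unfold_locales
    show "AE b in measure_pmf P. X e b \<in> {min 0 (c e)..max 0 (c e)}" for e
      by (rule AE_pmfI) (simp add: X_def)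
  qed (fact I indep eq_reflection[OF mean_sum])+
  have range: "(\<Sum>e\<in>I. (max 0 (c e) - min 0 (c e))\<^sup>2) = (\<Sum>e\<in>I. (c e)\<^sup>2)"
    by (intro sum.cong) (auto simp: max_def min_def)
  have "measure_pmf.prob P {b. t \<le> (\<Sum>e\<in>I. c e * (of_bool (b e) - q e))}
      = measure_pmf.prob P {b. (\<Sum>e\<in>I. c e * q e) + t \<le> (\<Sum>e\<in>I. X e b)}"
    by (simp add: X_def algebra_simps sum_subtractf)
  also have "\<dots> \<le> exp (- 2 * t\<^sup>2 / (\<Sum>e\<in>I. (c e)\<^sup>2))"
    using Hoeffding_ineq_ge[of t] t pos by (simp add: range)
  also have "\<dots> \<le> exp (- t\<^sup>2)"
  proof -
    have "t\<^sup>2 * (\<Sum>e\<in>I. (c e)\<^sup>2) \<le> t\<^sup>2 * 2" using V by (intro mult_left_mono) auto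
    then show ?thesis using pos by (simp add: field_simps)
  qed
  finally show ?thesis unfolding P_def .
qed

text \<open>Independence holds only above the diagonal, so the bilinear form is rewritten as a
  linear form in those entries.\<close>

lemma sum_symmetric_zero_diag:
  fixes G :: "nat \<Rightarrow> nat \<Rightarrow> real"
  assumes sym: "\<And>i j. G i j = G j i" and diag: "\<And>i. G i i = 0"
  shows "ip n x (mv n G y) = (\<Sum>(i,j)\<in>{(i,j). i < j \<and> j < n}. (x i * y j + x j * y i) * G i j)"
proof -
  let ?I = "{(i,j). i < j \<and> j < n}"
  let ?h = "\<lambda>(i,j). x i * (G i j * y j)"
  have fin: "finite ?I" by (rule finite_subset[of _ "{..<n} \<times> {..<n}"]) auto
  have "ip n x (mv n G y) = (\<Sum>z\<in>{..<n} \<times> {..<n}. ?h z)"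
    by (simp add: ip_def mv_def sum_distrib_left sum.cartesian_product)
  also have "\<dots> = (\<Sum>z\<in>?I \<union> prod.swap ` ?I. ?h z)"
  proof (rule sum.mono_neutral_right)
    show "\<forall>z\<in>{..<n} \<times> {..<n} - (?I \<union> prod.swap ` ?I). ?h z = 0"
    proof
      fix z assume z: "z \<in> {..<n} \<times> {..<n} - (?I \<union> prod.swap ` ?I)"
      obtain i j where ij: "z = (i,j)" by (cases z)
      have "i = j"
      proof (rule ccontr)
        assume "i \<noteq> j"
        then consider "i < j" | "j < i" by linarith
        then show False
        proof cases
          case 1 then show False using z ij by auto
        next
          case 2
          then have "(j,i) \<in> ?I" using z ij by auto
          then have "z \<in> prod.swap ` ?I" using ij by force
          then show False using z by simp
        qed
      qed
      then show "?h z = 0" using ij diag by simp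
    qed
  qed auto
  also have "\<dots> = (\<Sum>z\<in>?I. ?h z) + (\<Sum>z\<in>prod.swap ` ?I. ?h z)"
    by (rule sum.union_disjoint) (use fin in auto)
  also have "(\<Sum>z\<in>prod.swap ` ?I. ?h z) = (\<Sum>z\<in>?I. ?h (prod.swap z))"
    by (subst sum.reindex) (auto simp: inj_on_def)
  also have "(\<Sum>z\<in>?I. ?h z) + \<dots> = (\<Sum>(i,j)\<in>?I. (x i * y j + x j * y i) * G i j)"
    unfolding sum.distrib[symmetric]
  proof (intro sum.cong refl)
    fix z assume "z \<in> ?I"
    obtain i j where "z = (i,j)" by (cases z)
    then show "?h z + ?h (prod.swap z) = (case z of (i,j) \<Rightarrow> (x i * y j + x j * y i) * G i j)"
      using sym[of i j] by (simp add: algebra_simps)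
  qed
  finally show ?thesis .
qed

text \<open>After (v + w)^2 \<le> 2 (v^2 + w^2) the sum over edges is a bilinear form in the squared
  entries, for the 0-1 matrix \<open>G\<close> that vanishes only on the diagonal. The result is the
  variance condition of the Hoeffding bound for vectors in the unit ball.\<close>

lemma sum_edge_coeff_squares:
  "(\<Sum>(i,j)\<in>{(i,j). i < j \<and> j < n}. (x i * y j + x j * y i)\<^sup>2) \<le> 2 * (ip n x x * ip n y y)"
proof -
  define G where "G = (\<lambda>i j::nat. if i = j then 0 else (1::real))"
  let ?x = "\<lambda>i. (x i)\<^sup>2" and ?y = "\<lambda>i. (y i)\<^sup>2"
  have "(\<Sum>(i,j)\<in>{(i,j). i < j \<and> j < n}. (x i * y j + x j * y i)\<^sup>2)
      \<le> (\<Sum>(i,j)\<in>{(i,j). i < j \<and> j < n}. 2 * ((?x i * ?y j + ?x j * ?y i) * G i j))"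
  proof (rule sum_mono, clarify)
    fix i j :: nat assume "i < j" "j < n"
    have "(x i * y j + x j * y i)\<^sup>2 \<le> 2 * ((x i * y j)\<^sup>2 + (x j * y i)\<^sup>2)"
      using sum_squares_bound[of "x i * y j" "x j * y i"] by (simp add: power2_sum)
    then show "(x i * y j + x j * y i)\<^sup>2 \<le> 2 * ((?x i * ?y j + ?x j * ?y i) * G i j)"
      using \<open>i < j\<close> by (simp add: G_def power_mult_distrib)
  qed
  also have "\<dots> = 2 * ip n ?x (mv n G ?y)"
    by (subst sum_symmetric_zero_diag) (auto simp: G_def sum_distrib_left intro!: sum.cong)
  also have "\<dots> \<le> 2 * ip n ?x (\<lambda>_. \<Sum>j<n. ?y j)"
    unfolding ip_def mv_def G_def
    by (intro mult_left_mono sum_mono) (auto intro!: sum_mono)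
  also have "\<dots> = 2 * (ip n x x * ip n y y)"
    by (simp add: ip_def power2_eq_square sum_distrib_right)
  finally show ?thesis .
qed

definition adj :: "(nat \<times> nat \<Rightarrow> bool) \<Rightarrow> nat \<Rightarrow> nat \<Rightarrow> real" where
  "adj b i j = (if i = j then 0 else if b (min i j, max i j) then 1 else 0)"

lemma noise_form_tail:
  fixes m :: "nat \<Rightarrow> nat \<Rightarrow> real"
  assumes m: "\<And>i j. m i j = m j i" "\<And>i. m i i = 0" "\<And>i j. 0 \<le> m i j \<and> m i j \<le> 1"
    and x: "ip n x x \<le> 1" and y: "ip n y y \<le> 1" and t: "0 < t"
  shows "measure_pmf.prob (Pi_pmf {(i,j). i < j \<and> j < n} False (\<lambda>(i,j). bernoulli_pmf (m i j)))
    {b. t \<le> ip n x (mv n (\<lambda>i j. adj b i j - m i j) y)} \<le> exp (- t\<^sup>2)"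
proof -
  let ?I = "{(i,j). i < j \<and> j < n}"
  let ?c = "\<lambda>(i,j). x i * y j + x j * y i"
  have fin: "finite ?I" by (rule finite_subset[of _ "{..<n} \<times> {..<n}"]) auto
  have "ip n x x * ip n y y \<le> 1 * 1" by (intro mult_mono x y) auto
  then have V: "(\<Sum>e\<in>?I. (?c e)\<^sup>2) \<le> 2"
    using sum_edge_coeff_squares[of x y n] by (simp add: case_prod_unfold)
  have "ip n x (mv n (\<lambda>i j. adj b i j - m i j) y) = (\<Sum>e\<in>?I. ?c e * (of_bool (b e) - case_prod m e))" for b
  proof -
    have "ip n x (mv n (\<lambda>i j. adj b i j - m i j) y)
        = (\<Sum>(i,j)\<in>?I. (x i * y j + x j * y i) * (adj b i j - m i j))"
      by (rule sum_symmetric_zero_diag) (auto simp: adj_def m min.commute max.commute intro: m)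
    also have "\<dots> = (\<Sum>e\<in>?I. ?c e * (of_bool (b e) - case_prod m e))"
      by (intro sum.cong) (auto simp: adj_def min_def max_def)
    finally show ?thesis .
  qed
  then show ?thesis
    using hoeffding_Pi_bernoulli[OF fin _ V t, of "case_prod m"] m(3)
    by (simp add: case_prod_unfold)
qed

text \<open>Integer points which, divided by 4 sqrt n, fall in the unit ball. The box follows from
  the length bound for integers; with extensionality it makes the set visibly finite.\<close>

definition net :: "nat \<Rightarrow> (nat \<Rightarrow> int) set" where
  "net n = {w \<in> PiE {..<n} (\<lambda>_. {- int (16 * n)..int (16 * n)}). (\<Sum>i<n. (w i)\<^sup>2) \<le> int (16 * n)}"

definition net_vec :: "nat \<Rightarrow> (nat \<Rightarrow> int) \<Rightarrow> nat \<Rightarrow> real" where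
  "net_vec n w i = real_of_int (w i) / (4 * sqrt (real n))"

lemma sum_half_powers_le: "(\<Sum>k\<in>{- int N..int N}. (1/2::real) ^ nat \<bar>k\<bar>) \<le> 3"
proof -
  have "(\<Sum>k\<in>{- int N..int N}. (1/2::real) ^ nat \<bar>k\<bar>) = 3 - 2 * (1/2) ^ N"
  proof (induction N)
    case (Suc N)
    have "{- int (Suc N)..int (Suc N)} = insert (int (Suc N)) (insert (- int (Suc N)) {- int N..int N})"
      by auto
    then have "(\<Sum>k\<in>{- int (Suc N)..int (Suc N)}. (1/2::real) ^ nat \<bar>k\<bar>)
        = (1/2) ^ Suc N + ((1/2) ^ Suc N + (\<Sum>k\<in>{- int N..int N}. (1/2::real) ^ nat \<bar>k\<bar>))"
      by (simp add: nat_add_distrib)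
    then show ?case using Suc power_Suc[of "1/2::real" N] by linarith
  qed simp
  also have "\<dots> \<le> 3" by simp
  finally show ?thesis .
qed

text \<open>Counting with weights \<open>2 ^ (16 n - \<Sum>\<bar>w i\<bar>) \<ge> 1\<close>, which factorise over the coordinates.\<close>

lemma card_net: "finite (net n)" "real (card (net n)) \<le> 2 ^ (18 * n)"
proof -
  define R where "R = {- int (16 * n)..int (16 * n)}"
  define \<phi> where "\<phi> = (\<lambda>k::int. (1/2::real) ^ nat \<bar>k\<bar>)"
  have finP: "finite (PiE {..<n} (\<lambda>_. R))" by (intro finite_PiE) (auto simp: R_def)
  have sub: "net n \<subseteq> PiE {..<n} (\<lambda>_. R)" by (auto simp: net_def R_def)
  show fin: "finite (net n)" by (rule finite_subset[OF sub finP])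
  have w1: "1 \<le> 2 ^ (16 * n) * (\<Prod>i<n. \<phi> (w i))" if "w \<in> net n" for w
  proof -
    have "\<bar>k\<bar> \<le> k\<^sup>2" for k :: int
    proof (cases "k = 0")
      case False
      then have "\<bar>k\<bar> * 1 \<le> \<bar>k\<bar> * \<bar>k\<bar>" by (intro mult_left_mono) auto
      then show ?thesis by (simp add: power2_eq_square)
    qed simp
    then have "(\<Sum>i<n. \<bar>w i\<bar>) \<le> (\<Sum>i<n. (w i)\<^sup>2)" by (intro sum_mono) auto
    also have "\<dots> \<le> int (16 * n)" using that by (simp add: net_def)
    finally have "int (\<Sum>i<n. nat \<bar>w i\<bar>) \<le> int (16 * n)" by simp
    then have "(\<Sum>i<n. nat \<bar>w i\<bar>) \<le> 16 * n" by (simp only: of_nat_le_iff)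
    then have "(1/2::real) ^ (16 * n) \<le> (1/2) ^ (\<Sum>i<n. nat \<bar>w i\<bar>)"
      by (intro power_decreasing) auto
    also have "\<dots> = (\<Prod>i<n. \<phi> (w i))" by (simp add: \<phi>_def power_sum)
    finally show ?thesis by (simp add: power_divide field_simps)
  qed
  have "real (card (net n)) \<le> (\<Sum>w\<in>net n. 2 ^ (16 * n) * (\<Prod>i<n. \<phi> (w i)))"
    using sum_mono[of "net n" "\<lambda>_. 1::real"] w1 by simp
  also have "\<dots> \<le> (\<Sum>w\<in>PiE {..<n} (\<lambda>_. R). 2 ^ (16 * n) * (\<Prod>i<n. \<phi> (w i)))"
    by (rule sum_mono2[OF finP sub], intro mult_nonneg_nonneg prod_nonneg) (simp_all add: \<phi>_def)
  also have "\<dots> = 2 ^ (16 * n) * (\<Prod>i<n. \<Sum>k\<in>R. \<phi> k)"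
    by (subst prod_sum_PiE) (auto simp: R_def sum_distrib_left)
  \<comment> \<open>The series bound 3 is rounded up to 4 to stay with powers of 2: 16 n + 2 n = 18
    n.\<close>
  also have "\<dots> \<le> 2 ^ (16 * n) * (\<Prod>i<n. 4)"
  proof (intro mult_left_mono prod_mono conjI)
    show "0 \<le> (\<Sum>k\<in>R. \<phi> k)" by (auto simp: \<phi>_def intro!: sum_nonneg)
    show "(\<Sum>k\<in>R. \<phi> k) \<le> 4"
      using sum_half_powers_le[of "16 * n"] by (simp add: R_def \<phi>_def)
  qed simp
  also have "\<dots> = 2 ^ (18 * n)"
  proof -
    have "(4::real) ^ n = 2 ^ (2 * n)" by (simp add: power_mult)
    then show ?thesis by (simp flip: power_add)
  qed
  finally show "real (card (net n)) \<le> 2 ^ (18 * n)" .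
qed

lemma net_vec_norm:
  assumes "1 \<le> n" "w \<in> net n"
  shows "ip n (net_vec n w) (net_vec n w) \<le> 1"
proof -
  have "ip n (net_vec n w) (net_vec n w) = (\<Sum>i<n. (real_of_int (w i))\<^sup>2) / (16 * real n)"
    by (simp add: ip_self net_vec_def power_divide power_mult_distrib sum_divide_distrib)
  also have "(\<Sum>i<n. (real_of_int (w i))\<^sup>2) \<le> 16 * real n"
  proof -
    have "real_of_int (\<Sum>i<n. (w i)\<^sup>2) \<le> real_of_int (int (16 * n))"
      using assms unfolding of_int_le_iff by (simp add: net_def)
    then show ?thesis by simp
  qed
  finally show ?thesis using assms by (simp add: divide_right_mono)
qed

text \<open>Rounding \<open>Q * x\<close> towards zero never increases an entry in modulus, so the
  result stays in the net; each coordinate moves by at most 1 / Q, and n / Q^2 = 1/16.\<close>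

lemma net_approx:
  assumes n: "1 \<le> n" and x: "nrm n x \<le> 1"
  obtains w where "w \<in> net n" "nrm n (\<lambda>i. x i - net_vec n w i) \<le> 1 / 4"
proof -
  define Q where "Q = 4 * sqrt (real n)"
  have Q: "0 < Q" "Q\<^sup>2 = 16 * real n" using n by (simp_all add: Q_def power_mult_distrib)
  define r where "r = (\<lambda>x::real. if 0 \<le> x then \<lfloor>x\<rfloor> else \<lceil>x\<rceil>)"
  have r1: "\<bar>real_of_int (r v)\<bar> \<le> \<bar>v\<bar>" for v
  proof (cases "0 \<le> v")
    case True
    then have "0 \<le> real_of_int \<lfloor>v\<rfloor>" by simp
    then show ?thesis using True of_int_floor_le[of v] by (simp add: r_def)
  next
    case False
    then have "real_of_int \<lceil>v\<rceil> \<le> 0" by simp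
    then show ?thesis using False le_of_int_ceiling[of v] by (simp add: r_def)
  qed
  have r2: "\<bar>v - real_of_int (r v)\<bar> \<le> 1" for v
    unfolding r_def by (cases "0 \<le> v"; simp; linarith)
  define w where "w = restrict (\<lambda>i. r (Q * x i)) {..<n}"
  have "ip n x x \<le> 1" using x power_mono[OF x, of 2] by (simp add: nrm_sq)
  have "(\<Sum>i<n. (real_of_int (w i))\<^sup>2) \<le> (\<Sum>i<n. (Q * x i)\<^sup>2)"
    using r1 by (intro sum_mono) (auto simp: w_def abs_le_square_iff[symmetric])
  also have "\<dots> = Q\<^sup>2 * ip n x x" by (simp add: ip_self power_mult_distrib sum_distrib_left)
  also have "\<dots> \<le> 16 * real n" using mult_left_mono[OF \<open>ip n x x \<le> 1\<close>, of "Q\<^sup>2"] Q by simp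
  finally have "real_of_int (\<Sum>i<n. (w i)\<^sup>2) \<le> real_of_int (int (16 * n))" by simp
  then have sq: "(\<Sum>i<n. (w i)\<^sup>2) \<le> int (16 * n)" by (simp only: of_int_le_iff)
  have "w i \<in> {- int (16 * n)..int (16 * n)}" if "i < n" for i
  proof -
    have "(w i)\<^sup>2 \<le> (\<Sum>i<n. (w i)\<^sup>2)" by (rule member_le_sum) (use that in auto)
    moreover have "\<bar>w i\<bar> \<le> (w i)\<^sup>2"
      using self_le_power[of "\<bar>w i\<bar>" 2] by (cases "w i = 0") auto
    ultimately show ?thesis using sq by auto
  qed
  then have "w \<in> net n" using sq by (auto simp: net_def w_def PiE_def)
  moreover have "nrm n (\<lambda>i. x i - net_vec n w i) \<le> 1 / 4"
  proof (rule power2_le_imp_le)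
    have "(nrm n (\<lambda>i. x i - net_vec n w i))\<^sup>2 = (\<Sum>i<n. ((Q * x i - real_of_int (w i)) / Q)\<^sup>2)"
    proof -
      have "x i - net_vec n w i = (Q * x i - real_of_int (w i)) / Q" for i
        using Q(1) by (simp add: net_vec_def diff_divide_distrib flip: Q_def)
      then show ?thesis by (simp only: nrm_sq ip_self)
    qed
    also have "\<dots> \<le> (\<Sum>i<n. 1 / Q\<^sup>2)"
    proof (rule sum_mono)
      fix i assume "i \<in> {..<n}"
      then have "\<bar>Q * x i - real_of_int (w i)\<bar>\<^sup>2 \<le> 1\<^sup>2"
        using r2[of "Q * x i"] by (intro power_mono) (auto simp: w_def)
      then show "((Q * x i - real_of_int (w i)) / Q)\<^sup>2 \<le> 1 / Q\<^sup>2"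
        by (simp add: power_divide divide_right_mono)
    qed
    also have "\<dots> = (1 / 4)\<^sup>2" using n Q by (simp add: power2_eq_square)
    finally show "(nrm n (\<lambda>i. x i - net_vec n w i))\<^sup>2 \<le> (1 / 4)\<^sup>2" .
  qed simp
  ultimately show thesis by (rule that)
qed

text \<open>Let \<open>T\<close> be the supremum of the bilinear form over the unit ball. Replacing
  both arguments by net points costs T / 4 each, so T \<le> t + T / 2.\<close>

lemma operator_bound_from_net:
  assumes n: "1 \<le> n"
    and net: "\<And>w w'. w \<in> net n \<Longrightarrow> w' \<in> net n \<Longrightarrow> ip n (net_vec n w) (mv n E (net_vec n w')) \<le> t"
  shows "nrm n (mv n E x) \<le> 2 * t * nrm n x"
proof -
  define B where "B = {ip n x (mv n E y) |x y. nrm n x \<le> 1 \<and> nrm n y \<le> 1}"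
  define T where "T = Sup B"
  have coord: "\<bar>x i\<bar> \<le> 1" if "nrm n x \<le> 1" "i < n" for x i
  proof -
    have "\<bar>x i\<bar> \<le> nrm n x"
      using that member_le_L2_set[of "{..<n}" i "\<lambda>i. \<bar>x i\<bar>"] by (simp add: nrm_def L2_set_def)
    then show ?thesis using that by linarith
  qed
  \<comment> \<open>A crude entrywise bound: the supremum must be finite before it can be
    absorbed.\<close>
  have "z \<le> (\<Sum>i<n. \<Sum>j<n. \<bar>E i j\<bar>)" if zB: "z \<in> B" for z
  proof -
    obtain x y where xy: "nrm n x \<le> 1" "nrm n y \<le> 1" and z: "z = ip n x (mv n E y)"
      using zB unfolding B_def by blast
    have "z = (\<Sum>i<n. \<Sum>j<n. x i * (E i j * y j))" by (simp add: z ip_def mv_def sum_distrib_left)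
    also have "\<dots> \<le> (\<Sum>i<n. \<Sum>j<n. \<bar>E i j\<bar>)"
    proof (intro sum_mono)
      fix i j assume "i \<in> {..<n}" "j \<in> {..<n}"
      then have "\<bar>x i\<bar> * (\<bar>E i j\<bar> * \<bar>y j\<bar>) \<le> 1 * (\<bar>E i j\<bar> * 1)"
        using coord[OF xy(1)] coord[OF xy(2)] by (intro mult_mono) auto
      then show "x i * (E i j * y j) \<le> \<bar>E i j\<bar>"
        using abs_ge_self[of "x i * (E i j * y j)"] by (simp add: abs_mult)
    qed
    finally show ?thesis .
  qed
  then have bdd: "bdd_above B" by (rule bdd_aboveI)
  have le_T: "ip n x (mv n E y) \<le> T" if "nrm n x \<le> 1" "nrm n y \<le> 1" for x y
    unfolding T_def using that by (intro cSup_upper bdd) (auto simp: B_def)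
  have zero: "nrm n (\<lambda>_. 0) = 0" by (simp add: nrm_def L2_set_def)
  have "B \<noteq> {}" using zero by (auto simp: B_def intro!: exI[of _ "\<lambda>_. 0"])
  moreover have "z \<le> t + T / 2" if zB: "z \<in> B" for z
  proof -
    obtain x y where xy: "nrm n x \<le> 1" "nrm n y \<le> 1" and z: "z = ip n x (mv n E y)"
      using zB unfolding B_def by blast
    obtain w where w: "w \<in> net n" "nrm n (\<lambda>i. x i - net_vec n w i) \<le> 1 / 4" by (rule net_approx[OF n xy(1)])
    obtain w' where w': "w' \<in> net n" "nrm n (\<lambda>i. y i - net_vec n w' i) \<le> 1 / 4" by (rule net_approx[OF n xy(2)])
    let ?x = "net_vec n w" and ?y = "net_vec n w'"
    have "nrm n ?x \<le> 1"
      by (rule power2_le_imp_le) (use net_vec_norm[OF n w(1)] in \<open>simp_all add: nrm_sq\<close>)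
    \<comment> \<open>The errors are multiplied by 4 to return to the unit ball.\<close>
    then have 2: "ip n ?x (mv n E (\<lambda>i. 4 * (y i - ?y i))) \<le> T"
      using w'(2) by (intro le_T) (simp_all add: nrm_scale del: right_diff_distrib_numeral)
    have 1: "ip n (\<lambda>i. 4 * (x i - ?x i)) (mv n E y) \<le> T"
      using w(2) xy(2) by (intro le_T) (simp_all add: nrm_scale del: right_diff_distrib_numeral)
    have 3: "ip n ?x (mv n E ?y) \<le> t" by (rule net[OF w(1) w'(1)])
    have "ip n ?x (mv n E (\<lambda>i. 4 * (y i - ?y i))) = 4 * (ip n ?x (mv n E y) - ip n ?x (mv n E ?y))"
    proof -
      have "ip n ?x (mv n E (\<lambda>i. 4 * (y i - ?y i))) = ip n ?x (\<lambda>i. 4 * (mv n E y i - mv n E ?y i))"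
        by (rule ip_cong) (simp_all only: mv_scale mv_diff)
      then show ?thesis by (simp only: ip_scale_right ip_diff_right)
    qed
    moreover have "ip n (\<lambda>i. 4 * (x i - ?x i)) (mv n E y) = 4 * (z - ip n ?x (mv n E y))"
      by (simp only: z ip_scale_left ip_diff_left)
    ultimately show ?thesis using 1 2 3 by (simp add: field_simps)
  qed
  ultimately have "T \<le> t + T / 2" unfolding T_def by (intro cSup_least)
  then have T: "T \<le> 2 * t" by simp
  define v where "v = mv n E x"
  show ?thesis
  proof (cases "nrm n x = 0 \<or> nrm n v = 0")
    case True
    then have "nrm n v = 0"
    proof
      assume "nrm n x = 0"
      then have "ip n x x = 0" by (simp flip: nrm_sq)
      then have "mv n E x = mv n E (\<lambda>_. 0)" by (intro mv_cong) (simp add: ip_self_eq_0_iff)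
      moreover have "mv n E (\<lambda>_. 0) = (\<lambda>_. 0)" by (rule ext) (simp add: mv_def)
      ultimately show ?thesis using zero by (simp add: v_def)
    qed
    moreover have "0 \<le> T" using le_T[of "\<lambda>_. 0" "\<lambda>_. 0"] zero by (simp add: ip_def)
    ultimately show ?thesis using T by (simp add: v_def)
  next
    case False
    define V X where "V = nrm n v" and "X = nrm n x"
    have pos: "0 < V" "0 < X" using False by (simp_all add: V_def X_def order_less_le)
    \<comment> \<open>Testing the form on the normalised \<open>E x\<close> and \<open>x\<close>
      recovers the operator norm.\<close>
    have "ip n (\<lambda>i. (1 / V) * v i) (mv n E (\<lambda>i. (1 / X) * x i)) \<le> T"
      using pos by (intro le_T; simp only: nrm_scale) (simp_all add: V_def X_def)
    also have "mv n E (\<lambda>i. (1 / X) * x i) = (\<lambda>i. (1 / X) * v i)"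
      by (rule ext) (simp only: mv_scale v_def)
    also have "ip n (\<lambda>i. (1 / V) * v i) (\<lambda>i. (1 / X) * v i) = V / X"
      unfolding ip_scale_left ip_scale_right nrm_sq[symmetric] V_def[symmetric]
      using pos by (simp add: power2_eq_square)
    finally have "V / X \<le> 2 * t" using T by simp
    then show ?thesis using pos by (simp add: V_def[symmetric] X_def[symmetric] v_def[symmetric] field_simps)
  qed
qed

text \<open>A union bound over pairs of net points: there are at most 2^(36 n) \<le> exp(36 n) of
  them, each failing with probability at most exp(- 40 n). The constant 40 leaves exp(- 4 n) \<le>
  n^(-3).\<close>

lemma noise_operator_norm:
  fixes m :: "nat \<Rightarrow> nat \<Rightarrow> real"
  assumes n: "1 \<le> n"
    and m: "\<And>i j. m i j = m j i" "\<And>i. m i i = 0" "\<And>i j. 0 \<le> m i j \<and> m i j \<le> 1"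
  shows "1 - 1 / real n ^ 3 \<le>
    measure_pmf.prob (Pi_pmf {(i,j). i < j \<and> j < n} False (\<lambda>(i,j). bernoulli_pmf (m i j)))
      {b. \<forall>x. nrm n (\<lambda>i. mv n (adj b) x i - mv n m x i) \<le> 2 * sqrt (40 * real n) * nrm n x}"
proof -
  define P where "P = Pi_pmf {(i,j). i < j \<and> j < n} False (\<lambda>(i,j). bernoulli_pmf (m i j))"
  define t where "t = sqrt (40 * real n)"
  have t: "0 < t" "t\<^sup>2 = 40 * real n" using n by (simp_all add: t_def)
  define G where "G = {b. \<forall>x. nrm n (\<lambda>i. mv n (adj b) x i - mv n m x i) \<le> 2 * t * nrm n x}"
  define Bad where "Bad = (\<lambda>(w,w'). {b. t \<le> ip n (net_vec n w) (mv n (\<lambda>i j. adj b i j - m i j) (net_vec n w'))})"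
  have split: "mv n (\<lambda>i j. adj b i j - m i j) x = (\<lambda>i. mv n (adj b) x i - mv n m x i)" for b x
    by (rule ext) (simp add: mv_def left_diff_distrib sum_subtractf)
  have "- G \<subseteq> (\<Union>z\<in>net n \<times> net n. Bad z)"
  proof
    fix b assume b: "b \<in> - G"
    show "b \<in> (\<Union>z\<in>net n \<times> net n. Bad z)"
    proof (rule ccontr)
      assume "\<not> ?thesis"
      then have "ip n (net_vec n w) (mv n (\<lambda>i j. adj b i j - m i j) (net_vec n w')) \<le> t"
        if "w \<in> net n" "w' \<in> net n" for w w'
        using that by (force simp: Bad_def)
      from operator_bound_from_net[OF n this] have "b \<in> G" by (simp add: G_def split)
      then show False using b by simp
    qed
  qed
  then have "measure_pmf.prob P (- G) \<le> measure_pmf.prob P (\<Union>z\<in>net n \<times> net n. Bad z)"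
    by (intro measure_pmf.finite_measure_mono) auto
  also have "\<dots> \<le> (\<Sum>z\<in>net n \<times> net n. measure_pmf.prob P (Bad z))"
    using card_net(1) by (intro measure_pmf.finite_measure_subadditive_finite) auto
  also have "\<dots> \<le> (\<Sum>z\<in>net n \<times> net n. exp (- t\<^sup>2))"
    unfolding P_def Bad_def
    by (intro sum_mono) (auto intro!: noise_form_tail m net_vec_norm n t)
  also have "\<dots> = real (card (net n)) * real (card (net n)) * exp (- t\<^sup>2)"
    by (simp add: card_cartesian_product)
  also have "\<dots> \<le> exp (real (18 * n)) * exp (real (18 * n)) * exp (- t\<^sup>2)"
  proof -
    have "(2::real) \<le> exp 1" using exp_ge_add_one_self[of 1] by simp
    then have "(2::real) ^ (18 * n) \<le> exp 1 ^ (18 * n)" by (intro power_mono) auto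
    also have "\<dots> = exp (real (18 * n))" by (simp add: exp_of_nat_mult[symmetric])
    finally have "real (card (net n)) \<le> exp (real (18 * n))" using card_net(2)[of n] by linarith
    then show ?thesis by (intro mult_mono) auto
  qed
  also have "\<dots> = exp (- (4 * real n))" by (simp add: t(2) flip: exp_add)
  also have "\<dots> \<le> 1 / real n ^ 3"
  proof -
    have "real n \<le> exp (real n)" using exp_ge_add_one_self[of "real n"] by linarith
    then have "real n ^ 3 \<le> exp (real n) ^ 3" by (intro power_mono) auto
    also have "\<dots> = exp (3 * real n)" by (simp flip: exp_of_nat_mult)
    also have "\<dots> \<le> exp (4 * real n)" by simp
    finally show ?thesis using n by (simp add: exp_minus field_simps)
  qed
  finally have "measure_pmf.prob P (- G) \<le> 1 / real n ^ 3" .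
  moreover have "measure_pmf.prob P (- G) = 1 - measure_pmf.prob P G"
    using measure_pmf.prob_compl[of G P] by (simp add: Compl_eq_Diff_UNIV)
  ultimately show ?thesis unfolding P_def G_def t_def by linarith
qed

section \<open>From the noise bound to the Kendall distance\<close>

lemma kendall_le_square: "kendall n \<sigma> \<le> n * n"
proof -
  have "kendall n \<sigma> \<le> card ({..<n} \<times> {..<n})"
    unfolding kendall_def by (rule card_mono) auto
  then show ?thesis by (simp add: card_cartesian_product)
qed

text \<open>The deterministic part. The threshold on \<open>s\<close> is equivalent to
  \<open>\<delta> \<le> a / 1000\<close>, as \<open>\<delta>^2\<close> is 320 s.\<close>

lemma kendall_le_of_noise_bound:
  fixes A :: "real mat" and y :: "real vec"
  assumes p: "0 < p" "p < 1" and s: "320000000 / p\<^sup>2 \<le> real s"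
    and A: "A \<in> carrier_mat (2 * s) (2 * s)"
    and sym: "\<And>i j. i < 2 * s \<Longrightarrow> j < 2 * s \<Longrightarrow> A $$ (i,j) = A $$ (j,i)"
    and near: "\<And>x. nrm (2 * s) (\<lambda>i. mv (2 * s) (\<lambda>i j. A $$ (i,j)) x i - mv (2 * s) (band p s) x i)
      \<le> 2 * sqrt (40 * real (2 * s)) * nrm (2 * s) x"
    and lam: "is_lambda2 A lam" and y: "y \<in> carrier_vec (2 * s)" "A *\<^sub>v y = lam \<cdot>\<^sub>v y"
      "y \<bullet> y = 1" "0 \<le> y \<bullet> u_vec s" and \<sigma>: "sorts (2 * s) \<sigma> y"
  shows "real (kendall (2 * s) \<sigma>) \<le> (25600000 / p\<^sup>2 + 2) * real (2 * s) powr (9/5)"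
proof -
  define n where "n = 2 * s"
  define a where "a = p * real s"
  define \<delta> where "\<delta> = 2 * sqrt (40 * real n)"
  define u where "u = (\<lambda>j. u_fun s (j + 1))"
  define Y where "Y = (\<lambda>i. y $ i)"
  let ?A = "\<lambda>i j. A $$ (i,j)"
  have "p\<^sup>2 < 1" using p by (simp add: power_less_one_iff)
  then have "1 \<le> 1 / p\<^sup>2" using p by simp
  \<comment> \<open>From 1500 on, 2.998 s \<le> 3 (s - 1) holds, and also 0.624 s \<le> 0.625 s -
    1.\<close>
  then have s_large: "1500 \<le> real s" using s by simp
  then have s1: "1 \<le> s" by linarith
  have a0: "0 < a" using p s_large by (simp add: a_def)
  have \<delta>2: "\<delta>\<^sup>2 = 320 * real s" by (simp add: \<delta>_def n_def power_mult_distrib)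
  have \<delta>a: "\<delta> \<le> a / 1000"
  proof (rule power2_le_imp_le)
    have "320000000 \<le> real s * p\<^sup>2" using s p by (simp add: field_simps)
    then have "320000000 * real s \<le> real s * p\<^sup>2 * real s" by (intro mult_right_mono) auto
    then show "\<delta>\<^sup>2 \<le> (a / 1000)\<^sup>2" unfolding \<delta>2 by (simp add: a_def power2_eq_square field_simps)
  qed (use a0 in simp)
  obtain es where cp: "char_poly A = (\<Prod>e\<leftarrow>es. [:- e, 1:])"
    and srt: "sorted_wrt (\<lambda>a b. \<bar>b\<bar> \<le> \<bar>a\<bar>) es" and es1: "es ! 1 = lam"
    using lam unfolding is_lambda2_def by blast
  obtain f where len: "length es = n" and on: "orthonormal n n f"
    and ev: "\<And>k i. k < n \<Longrightarrow> i < n \<Longrightarrow> mv n ?A (f k) i = es ! k * f k i"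
    using symmetric_eigenbasis[OF A sym cp] unfolding n_def by metis
  have Uge: "2 * ((real j - real i) / (real n + 1))\<^sup>2 \<le> u i - u j" if "i < j" "j < n" for i j
    using u_fun_gap[of "i + 1" "j + 1" s] that by (simp add: u_def n_def)
  have Upos: "0 < nrm n u"
  proof (rule ccontr)
    assume "\<not> ?thesis"
    then have "nrm n u = 0" using nrm_nonneg[of n u] by linarith
    then have "ip n u u = 0" by (simp flip: nrm_sq)
    then have "u 0 = 0" "u 1 = 0" using s1 by (auto simp: ip_self_eq_0_iff n_def)
    moreover have "0 < 2 * ((real 1 - real 0) / (real n + 1))\<^sup>2"
      by (intro mult_pos_pos zero_less_power) (simp_all add: add_nonneg_pos)
    ultimately show False using Uge[of 0 1] s1 by (simp add: n_def)
  qed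
  have U2: "(nrm n u)\<^sup>2 \<le> 2 * real s"
  proof -
    have "(u i)\<^sup>2 \<le> 1" for i by (simp add: u_def u_fun_def abs_square_le_1)
    then have "(\<Sum>i<n. (u i)\<^sup>2) \<le> (\<Sum>i<n. 1)" by (intro sum_mono) auto
    then show ?thesis by (simp add: nrm_sq ip_self n_def)
  qed
  have dimy: "dim_vec y = n" using y(1) by (simp add: n_def)
  have ipy: "ip n Y Y = 1" using y(3) dimy
    by (simp add: ip_def Y_def scalar_prod_def lessThan_atLeast0)
  have ipu: "y \<bullet> u_vec s = ip n Y u"
    by (simp add: ip_def Y_def u_def u_vec_def n_def scalar_prod_def lessThan_atLeast0)
  have Ay: "mv n ?A Y i = es ! 1 * Y i" if "i < n" for i
  proof -
    have "(A *\<^sub>v y) $ i = mv n ?A Y i"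
      using that A dimy by (simp add: mv_def Y_def n_def scalar_prod_def lessThan_atLeast0)
    then show ?thesis unfolding y(2) using that dimy es1 by (simp add: Y_def)
  qed
  have "(\<Sum>i<n. (nrm n u * Y i - u i)\<^sup>2) \<le> 2 * (nrm n u)\<^sup>2 * (\<delta> / (a / 100))\<^sup>2"
  proof (rule second_eigenvector_perturbation[where M = "band p s" and A = ?A and \<mu> = "band_eigenvalue p s" and f = f and ev = "\<lambda>k. es ! k"])
    show "3 \<le> n" using s_large by (simp add: n_def)
    show "0 \<le> \<delta>" by (simp add: \<delta>_def)
    show "(\<Sum>i<n. \<Sum>j<n. (band p s i j)\<^sup>2) \<le> 3 * a\<^sup>2"
      unfolding n_def band_hilbert_schmidt[OF s1] a_def power_mult_distrib
      using p s_large by (simp add: power2_eq_square[of "real s"] mult.assoc)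
    have "1.499 * a * real n = p * real s * (2.998 * real s)" by (simp add: a_def n_def)
    also have "\<dots> \<le> p * real s * (3 * (real s - 1))"
      using p s_large by (intro mult_left_mono) auto
    also have "\<dots> = 3 * p * real s * (real s - 1)" by simp
    finally show "1.499 * a * real n \<le> (\<Sum>i<n. \<Sum>j<n. band p s i j)"
      unfolding n_def band_sum[OF s1] .
    show "mv n (band p s) u i = band_eigenvalue p s * u i" if "i < n" for i
      using mv_band_u[OF s1] that by (simp add: n_def u_def)
    have "0.624 * a = p * (0.624 * real s)" by (simp add: a_def)
    also have "\<dots> \<le> p * (0.625 * real s - 1)" using p s_large by (intro mult_left_mono) auto
    finally show "0.624 * a \<le> band_eigenvalue p s" using band_eigenvalue_bounds(1)[OF s1 p(1)] by linarith
    show "band_eigenvalue p s \<le> a" using band_eigenvalue_bounds(2)[OF s1 p(1)] by (simp add: a_def)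
    show "\<bar>es ! l\<bar> \<le> \<bar>es ! k\<bar>" if "k \<le> l" "l < n" for k l
      using srt that len by (cases "k = l") (auto simp: sorted_wrt_iff_nth_less)
    show "nrm n (\<lambda>i. mv n ?A x i - mv n (band p s) x i) \<le> \<delta> * nrm n x" for x
      using near[of x] by (simp add: n_def \<delta>_def)
    show "0 \<le> ip n Y u" using y(4) ipu by simp
  qed (use a0 \<delta>a Upos sym on ev Ay ipy in \<open>auto simp: n_def\<close>)
  also have "\<dots> \<le> 2 * (2 * real s) * (\<delta> / (a / 100))\<^sup>2"
    by (intro mult_mono mult_left_mono U2) auto
  also have "\<dots> = 12800000 / p\<^sup>2"
    unfolding power_divide \<delta>2 a_def using p s_large by (simp add: field_simps power2_eq_square)
  finally have close: "(\<Sum>i<n. (nrm n u * Y i - u i)\<^sup>2) \<le> 12800000 / p\<^sup>2" .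
  \<comment> \<open>Scaling \<open>y\<close> by the norm of \<open>u\<close> makes the two vectors
    comparable and keeps the sorting permutation.\<close>
  have "real (kendall n \<sigma>) \<le> (2 * (12800000 / p\<^sup>2) + 2) * real n powr (9/5)"
  proof (rule kendall_le_of_l2_close[OF _ _ Uge close])
    show "nrm n u * Y (\<sigma> j) \<le> nrm n u * Y (\<sigma> i)" if "i < j" "j < n" for i j
      using \<sigma> that by (intro mult_left_mono) (auto simp: sorts_def Y_def n_def)
  qed (use s1 \<sigma> in \<open>auto simp: n_def sorts_def\<close>)
  then show ?thesis by (simp add: n_def)
qed

theorem theorem4:
  fixes p :: real
  assumes "0 < p" and "p < 1"
  shows "\<exists>C > 0. \<forall>s \<ge> 1.
    measure_pmf.prob (random_M p s)
      {A. \<forall>lam y \<sigma>. is_lambda2 A lam \<and> y \<in> carrier_vec (2 * s) \<and>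
            A *\<^sub>v y = lam \<cdot>\<^sub>v y \<and> y \<bullet> y = 1 \<and> 0 \<le> y \<bullet> u_vec s \<and> sorts (2 * s) \<sigma> y
          \<longrightarrow> real (kendall (2 * s) \<sigma>) \<le> C * real (2 * s) powr (9/5)}
    \<ge> 1 - 1 / real (2 * s) ^ 3"
proof -
  \<comment> \<open>\<open>C\<close> covers both ranges: it exceeds n = 2 s below the threshold,
    where the bound n^2 on the Kendall distance suffices, and the constant of the deterministic part
    above it.\<close>
  define C where "C = 640000000 / p\<^sup>2 + 2"
  have C: "0 < C" using assms by (simp add: C_def add_pos_pos)
  have "1 - 1 / real (2 * s) ^ 3 \<le> measure_pmf.prob (random_M p s)
      {A. \<forall>lam y \<sigma>. is_lambda2 A lam \<and> y \<in> carrier_vec (2 * s) \<and>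
            A *\<^sub>v y = lam \<cdot>\<^sub>v y \<and> y \<bullet> y = 1 \<and> 0 \<le> y \<bullet> u_vec s \<and> sorts (2 * s) \<sigma> y
          \<longrightarrow> real (kendall (2 * s) \<sigma>) \<le> C * real (2 * s) powr (9/5)}"
    (is "_ \<le> measure_pmf.prob _ ?S") if s: "1 \<le> s" for s
  proof (cases "320000000 / p\<^sup>2 \<le> real s")
    case False
    have "real (kendall (2 * s) \<sigma>) \<le> C * real (2 * s) powr (9/5)" for \<sigma>
    proof -
      have "real (2 * s) \<le> C" using False by (simp add: C_def)
      have "real (kendall (2 * s) \<sigma>) \<le> real (2 * s) * real (2 * s)"
        using kendall_le_square[of "2 * s" \<sigma>] by (metis of_nat_le_iff of_nat_mult)
      also have "\<dots> \<le> C * real (2 * s) powr (9/5)"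
      proof (intro mult_mono \<open>real (2 * s) \<le> C\<close>)
        show "real (2 * s) \<le> real (2 * s) powr (9/5)"
          using s powr_mono[of 1 "9/5" "real (2 * s)"] by simp
      qed (use C in auto)
      finally show ?thesis .
    qed
    then have "?S = UNIV" by blast
    then show ?thesis by simp
  next
    case True
    define I where "I = {(i,j). i < j \<and> j < 2 * s}"
    define P where "P = Pi_pmf I False (\<lambda>(i,j). bernoulli_pmf (band p s i j))"
    define F where "F = (\<lambda>b. mat (2 * s) (2 * s) (\<lambda>(i,j).
                 if i = j then 0 else if b (min i j, max i j) then 1 else (0::real)))"
    have finI: "finite I" unfolding I_def by (rule finite_subset[of _ "{..<2 * s} \<times> {..<2 * s}"]) auto
    have rM: "random_M p s = map_pmf F P"
      unfolding random_M_def F_def P_def I_def[symmetric]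
      by (intro arg_cong[where f = "map_pmf _"] Pi_pmf_cong finI)
        (auto simp: I_def band_M_index[OF s])
    define G where "G = {b. \<forall>x. nrm (2 * s) (\<lambda>i. mv (2 * s) (adj b) x i - mv (2 * s) (band p s) x i)
      \<le> 2 * sqrt (40 * real (2 * s)) * nrm (2 * s) x}"
    have "1 - 1 / real (2 * s) ^ 3 \<le> measure_pmf.prob P G"
      unfolding P_def G_def I_def
      by (rule noise_operator_norm) (use s assms in \<open>auto simp: band_def\<close>)
    \<comment> \<open>The noise event does not mention eigenvectors, so on it the bound holds for
      every admissible \<open>lam\<close>, \<open>y\<close> and \<open>\<sigma>\<close> at
      once.\<close>
    also have "\<dots> \<le> measure_pmf.prob P (F -` ?S)"
    proof (intro measure_pmf.finite_measure_mono subsetI)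
      fix b assume b: "b \<in> G"
      have F: "F b $$ (i,j) = adj b i j" if "i < 2 * s" "j < 2 * s" for i j
        using that by (simp add: F_def adj_def)
      have Fmv: "mv (2 * s) (\<lambda>i j. F b $$ (i,j)) x i = mv (2 * s) (adj b) x i" if "i < 2 * s" for x i
        using that by (simp add: mv_def F)
      have "nrm (2 * s) (\<lambda>i. mv (2 * s) (\<lambda>i j. F b $$ (i,j)) x i - mv (2 * s) (band p s) x i)
          = nrm (2 * s) (\<lambda>i. mv (2 * s) (adj b) x i - mv (2 * s) (band p s) x i)" for x
        by (rule nrm_cong) (simp add: Fmv)
      then have near: "nrm (2 * s) (\<lambda>i. mv (2 * s) (\<lambda>i j. F b $$ (i,j)) x i - mv (2 * s) (band p s) x i)
          \<le> 2 * sqrt (40 * real (2 * s)) * nrm (2 * s) x" for x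
        using b by (simp add: G_def)
      have carr: "F b \<in> carrier_mat (2 * s) (2 * s)" by (simp add: F_def)
      have sym: "F b $$ (i,j) = F b $$ (j,i)" if "i < 2 * s" "j < 2 * s" for i j
        using that by (simp add: F adj_def min.commute max.commute)
      have "real (kendall (2 * s) \<sigma>) \<le> C * real (2 * s) powr (9/5)"
        if "is_lambda2 (F b) lam" "y \<in> carrier_vec (2 * s)" "F b *\<^sub>v y = lam \<cdot>\<^sub>v y"
          "y \<bullet> y = 1" "0 \<le> y \<bullet> u_vec s" "sorts (2 * s) \<sigma> y" for lam \<sigma> and y :: "real vec"
      proof -
        have "real (kendall (2 * s) \<sigma>) \<le> (25600000 / p\<^sup>2 + 2) * real (2 * s) powr (9/5)"
          by (rule kendall_le_of_noise_bound[OF assms True carr sym near that])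
        also have "\<dots> \<le> C * real (2 * s) powr (9/5)"
          by (intro mult_right_mono) (auto simp: C_def divide_right_mono)
        finally show ?thesis .
      qed
      then show "b \<in> F -` ?S" by blast
    qed simp
    also have "\<dots> = measure_pmf.prob (random_M p s) ?S"
      unfolding rM by simp
    finally show ?thesis .
  qed
  then show ?thesis using C by blast
qed

end
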